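(* For every $t\in\{0,1,2,\dots\}$ and every $D\in\mathcal B(\mathcal I)$, $$\mathbb P(I_{t+1}\in D\mid\mathcal H_t)=\mathcal K(D\mid I_t,U_t)\qquad\mathbb P\text{-almost surely}.$$ Consequently, $$\mathbb P(I_{t+1}\in D\mid\mathscr I_t,U_t)=\mathcal K(D\mid I_t,U_t)\qquad\mathbb P\text{-almost surely}.$$ Thus $\{I_t\}$ is a completely observable controlled Markov process with transition kernel $\mathcal K$.
   Context: Model. $(\Omega,\mathcal F,\mathbb P)$ is a complete probability space; $\mathcal X$ (states), $\mathcal U$ (actions), $\mathsf E$, $\mathsf V$ (noises) are standard Borel spaces; $\mathcal P(\mathcal X)$ is the set of probability measures on $\mathcal X$ with the $\sigma$-field generated by the evaluations $\mu\mapsto\mu(C)$. $G:\mathcal X\times\mathcal U\times\mathsf E\times\mathsf V\to\mathcal X$ is Borel measurable and $X_{t+1}=G(X_t,U_t,\eta_{t+1},\varepsilon_{t+1})$ for $t\ge 0$, where $(\eta_t)_{t\ge1}$ is i.i.d. with law $\nu_\eta$, $(\varepsilon_t)_{t\ge1}$ is i.i.d. with law $\nu_\varepsilon$, and $X_0$, $(\eta_t)_t$, $(\varepsilon_t)_t$ are mutually independent. $Q(C\mid x,u)=\int_{\mathsf E}\int_{\mathsf V}\mathbf 1_C(G(x,u,e,v))\,\nu_\varepsilon(dv)\,\nu_\eta(de)$. Observations. $A_1,\dots,A_m$ is a finite measurable partition of $\mathcal X$; $O_j=\bigcup_{i\in J_j}A_i$ for $j=1,\dots,r$, with $J_1,\dots,J_r\subseteq\{1,\dots,m\}$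 nonempty and pairwise disjoint; $O_{r+1}=\mathcal X\setminus\bigcup_{j\le r}O_j$. $\mathsf J=\{j\in\{1,\dots,r+1\}:O_j\neq\varnothing\}$. $Y_t=j\iff X_t\in O_j$. $\mathcal H_t=\sigma(Y_0,U_0,Y_1,\dots,U_{t-1},Y_t)$, $\mathcal H_0=\sigma(Y_0)$; each $U_t$ is $\mathcal H_t$-measurable (and admissible). $\pi_t(C)=\mathbb P(X_t\in C\mid\mathcal H_t)$ is a regular version with values in $\mathcal P(\mathcal X)$. Filter operators. For $\mu\in\mathcal P(\mathcal X)$, $u\in\mathcal U$, $k\in\mathsf J$: $(\mathcal L_u\mu)(C)=\int_{\mathcal X}Q(C\mid x,u)\,\mu(dx)$; $\widetilde{\mathcal L}_{u,k}\mu(C)=(\mathcal L_u\mu)(C\cap O_k)$; $p_k(\mu,u)=(\mathcal L_u\mu)(O_k)$. Fix $\rho_k\in\mathcal P(\mathcal X)$ with $\rho_k(O_k)=1$; $\Phi_k(\mu,u)=\widetilde{\mathcal L}_{u,k}\mu/p_k(\mu,u)$ if $p_k(\mu,u)>0$ and $\Phi_k(\mu,u)=\rho_k$ otherwise. Information state. $\mathcal P_j=\{\mu\in\mathcal P(\mathcal X):\mu(O_j)=1\}$, $\mathcal I=\bigcup_{j\in\mathsf J}(\{j\}\times\mathcal P_j)$ with the trace $\sigma$-field of $\mathsf J\times\mathcal P(\mathcal X)$; $I_t=(Y_t,\pi_t)$. $\mathscr I_t=\sigma(I_0,U_0,I_1,U_1,\dots,U_{t-1},I_t)$. The kernel is,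 for $I=(j,\mu)$, $\mathcal K(D\mid I,u)=\sum_{k\in\mathsf J}p_k(\mu,u)\,\mathbf 1_D\bigl((k,\Phi_k(\mu,u))\bigr)$. *)

theory Defs
  imports "HOL-Probability.Probability"
begin

definition standard_borel_space :: "'a measure \<Rightarrow> bool" where
  "standard_borel_space S \<longleftrightarrow>
     (\<exists>T. completely_metrizable_space T \<and> second_countable T \<and> topspace T = space S \<and>
          sets S = sigma_sets (space S) {V. openin T V})"

definition process_events ::
  "'w measure \<Rightarrow> 'a measure \<Rightarrow> (nat \<Rightarrow> 'w \<Rightarrow> 'a) \<Rightarrow> nat set \<Rightarrow> 'w set set" where
  "process_events M S Z T =
     sigma_sets (space M) (\<Union>t\<in>T. {Z t -` B \<inter> space M | B. B \<in> sets S})"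

text \<open>
  \<open>history M S Z SU U t\<close> is the \<open>\<sigma>\<close>-field \<open>\<sigma>(Z\<^sub>0, U\<^sub>0, Z\<^sub>1, \<dots>, U\<^sub>t\<^sub>-\<^sub>1, Z\<^sub>t)\<close>, and
  \<open>history_action\<close> additionally contains \<open>\<sigma>(U\<^sub>t)\<close>. They are used only as
  sub-\<open>\<sigma>\<close>-fields; the measure that \<^const>\<open>sigma\<close> puts on them is irrelevant.
\<close>

definition history ::
  "'w measure \<Rightarrow> 'a measure \<Rightarrow> (nat \<Rightarrow> 'w \<Rightarrow> 'a) \<Rightarrow> 'u measure \<Rightarrow> (nat \<Rightarrow> 'w \<Rightarrow> 'u) \<Rightarrow>
     nat \<Rightarrow> 'w measure" where
  "history M S Z SU U t =
     sigma (space M) (process_events M S Z {..t} \<union> process_events M SU U {..<t})"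

definition history_action ::
  "'w measure \<Rightarrow> 'a measure \<Rightarrow> (nat \<Rightarrow> 'w \<Rightarrow> 'a) \<Rightarrow> 'u measure \<Rightarrow> (nat \<Rightarrow> 'w \<Rightarrow> 'u) \<Rightarrow>
     nat \<Rightarrow> 'w measure" where
  "history_action M S Z SU U t =
     sigma (space M) (process_events M S Z {..t} \<union> process_events M SU U {..t})"

definition cond_probability ::
  "'w measure \<Rightarrow> 'w measure \<Rightarrow> ('w \<Rightarrow> 'a) \<Rightarrow> 'a set \<Rightarrow> 'w \<Rightarrow> real" where
  "cond_probability M F Z C = real_cond_exp M F (indicator {\<omega> \<in> space M. Z \<omega> \<in> C})"

definition transition_kernel ::
  "'x measure \<Rightarrow> 'e measure \<Rightarrow> 'v measure \<Rightarrow> ('x \<times> 'u \<times> 'e \<times> 'v \<Rightarrow> 'x) \<Rightarrow>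
     'x \<Rightarrow> 'u \<Rightarrow> 'x measure" where
  "transition_kernel SX \<nu>\<^sub>\<eta> \<nu>\<^sub>\<epsilon> G x u =
     measure_of (space SX) (sets SX)
       (\<lambda>C. \<integral>\<^sup>+ e. (\<integral>\<^sup>+ v. indicator C (G (x, u, e, v)) \<partial>\<nu>\<^sub>\<epsilon>) \<partial>\<nu>\<^sub>\<eta>)"

definition obs_cell ::
  "'x measure \<Rightarrow> (nat \<Rightarrow> 'x set) \<Rightarrow> (nat \<Rightarrow> nat set) \<Rightarrow> nat \<Rightarrow> nat \<Rightarrow> 'x set" where
  "obs_cell SX A J r j =
     (if j = r + 1 then space SX - (\<Union>l\<in>{1..r}. \<Union>i\<in>J l. A i) else (\<Union>i\<in>J j. A i))"

definition obs_labels :: "(nat \<Rightarrow> 'x set) \<Rightarrow> nat \<Rightarrow> nat set" where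
  "obs_labels Oc r = {j \<in> {1..r + 1}. Oc j \<noteq> {}}"

definition predict :: "'x measure \<Rightarrow> ('x \<Rightarrow> 'u \<Rightarrow> 'x measure) \<Rightarrow> 'u \<Rightarrow> 'x measure \<Rightarrow> 'x measure" where
  "predict SX Q u \<mu> =
     measure_of (space SX) (sets SX) (\<lambda>C. \<integral>\<^sup>+ x. emeasure (Q x u) C \<partial>\<mu>)"

definition predict_on ::
  "'x measure \<Rightarrow> ('x \<Rightarrow> 'u \<Rightarrow> 'x measure) \<Rightarrow> (nat \<Rightarrow> 'x set) \<Rightarrow> 'u \<Rightarrow> nat \<Rightarrow>
     'x measure \<Rightarrow> 'x measure" where
  "predict_on SX Q Oc u k \<mu> =
     measure_of (space SX) (sets SX) (\<lambda>C. emeasure (predict SX Q u \<mu>) (C \<inter> Oc k))"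

definition obs_prob ::
  "'x measure \<Rightarrow> ('x \<Rightarrow> 'u \<Rightarrow> 'x measure) \<Rightarrow> (nat \<Rightarrow> 'x set) \<Rightarrow> nat \<Rightarrow> 'x measure \<Rightarrow> 'u \<Rightarrow> real" where
  "obs_prob SX Q Oc k \<mu> u = measure (predict SX Q u \<mu>) (Oc k)"

definition filter_update ::
  "'x measure \<Rightarrow> ('x \<Rightarrow> 'u \<Rightarrow> 'x measure) \<Rightarrow> (nat \<Rightarrow> 'x set) \<Rightarrow> (nat \<Rightarrow> 'x measure) \<Rightarrow> nat \<Rightarrow>
     'x measure \<Rightarrow> 'u \<Rightarrow> 'x measure" where
  "filter_update SX Q Oc \<rho> k \<mu> u =
     (if obs_prob SX Q Oc k \<mu> u > 0
      then scale_measure (1 / ennreal (obs_prob SX Q Oc k \<mu> u)) (predict_on SX Q Oc u k \<mu>)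
      else \<rho> k)"

definition label_space :: "(nat \<Rightarrow> 'x set) \<Rightarrow> nat \<Rightarrow> nat measure" where
  "label_space Oc r = count_space (obs_labels Oc r)"

definition beliefs_on :: "'x measure \<Rightarrow> (nat \<Rightarrow> 'x set) \<Rightarrow> nat \<Rightarrow> 'x measure set" where
  "beliefs_on SX Oc j = {\<mu> \<in> space (prob_algebra SX). measure \<mu> (Oc j) = 1}"

definition info_states :: "'x measure \<Rightarrow> (nat \<Rightarrow> 'x set) \<Rightarrow> nat \<Rightarrow> (nat \<times> 'x measure) set" where
  "info_states SX Oc r = (\<Union>j\<in>obs_labels Oc r. {j} \<times> beliefs_on SX Oc j)"

definition info_ambient ::
  "'x measure \<Rightarrow> (nat \<Rightarrow> 'x set) \<Rightarrow> nat \<Rightarrow> (nat \<times> 'x measure) measure" where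
  "info_ambient SX Oc r = label_space Oc r \<Otimes>\<^sub>M prob_algebra SX"

definition info_space ::
  "'x measure \<Rightarrow> (nat \<Rightarrow> 'x set) \<Rightarrow> nat \<Rightarrow> (nat \<times> 'x measure) measure" where
  "info_space SX Oc r = restrict_space (info_ambient SX Oc r) (info_states SX Oc r)"

definition info_kernel ::
  "'x measure \<Rightarrow> ('x \<Rightarrow> 'u \<Rightarrow> 'x measure) \<Rightarrow> (nat \<Rightarrow> 'x set) \<Rightarrow> nat \<Rightarrow> (nat \<Rightarrow> 'x measure) \<Rightarrow>
     (nat \<times> 'x measure) set \<Rightarrow> nat \<times> 'x measure \<Rightarrow> 'u \<Rightarrow> real" where
  "info_kernel SX Q Oc r \<rho> D I u =
     (\<Sum>k\<in>obs_labels Oc r.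
        obs_prob SX Q Oc k (snd I) u * indicator D (k, filter_update SX Q Oc \<rho> k (snd I) u))"

definition stochastic_kernel ::
  "'s measure \<Rightarrow> 'u measure \<Rightarrow> ('s set \<Rightarrow> 's \<Rightarrow> 'u \<Rightarrow> real) \<Rightarrow> bool" where
  "stochastic_kernel S SU K \<longleftrightarrow>
     (\<forall>D\<in>sets S. (\<lambda>(s, u). K D s u) \<in> borel_measurable (S \<Otimes>\<^sub>M SU)) \<and>
     (\<forall>s\<in>space S. \<forall>u\<in>space SU. \<exists>\<kappa>\<in>space (prob_algebra S). \<forall>D\<in>sets S. K D s u = measure \<kappa> D)"

definition markov_transitions ::
  "'w measure \<Rightarrow> (nat \<Rightarrow> 'w measure) \<Rightarrow> 's measure \<Rightarrow> ('s set \<Rightarrow> 's \<Rightarrow> 'u \<Rightarrow> real) \<Rightarrow>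
     (nat \<Rightarrow> 'w \<Rightarrow> 's) \<Rightarrow> (nat \<Rightarrow> 'w \<Rightarrow> 'u) \<Rightarrow> bool" where
  "markov_transitions M F S K I U \<longleftrightarrow>
     (\<forall>t. \<forall>D\<in>sets S. AE \<omega> in M. cond_probability M (F t) (I (Suc t)) D \<omega> = K D (I t \<omega>) (U t \<omega>))"

text \<open>
  The state space is the trace of the measurable space \<open>N\<close> on the set \<open>St\<close>. The process is a random
  element of \<open>N\<close> which lies in \<open>St\<close> almost surely (not necessarily everywhere), since conditional
  laws are determined only up to null sets. If it lies in \<open>St\<close> everywhere, the \<open>\<sigma>\<close>-fields
  it generates through \<open>N\<close> and through the trace of \<open>N\<close> on \<open>St\<close> coincide.
  Complete observability means that the state is known from the information \<open>F t\<close> of the controller,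
  and that actions are functions of the state-action history.
\<close>

definition completely_observable_controlled_markov ::
  "'w measure \<Rightarrow> (nat \<Rightarrow> 'w measure) \<Rightarrow> 's measure \<Rightarrow> 's set \<Rightarrow> 'u measure \<Rightarrow>
     ('s set \<Rightarrow> 's \<Rightarrow> 'u \<Rightarrow> real) \<Rightarrow> (nat \<Rightarrow> 'w \<Rightarrow> 's) \<Rightarrow> (nat \<Rightarrow> 'w \<Rightarrow> 'u) \<Rightarrow> bool" where
  "completely_observable_controlled_markov M F N St SU K I U \<longleftrightarrow>
     stochastic_kernel (restrict_space N St) SU K \<and>
     (\<forall>t. I t \<in> M \<rightarrow>\<^sub>M N) \<and> (\<forall>t. AE \<omega> in M. I t \<omega> \<in> St) \<and> (\<forall>t. U t \<in> M \<rightarrow>\<^sub>M SU) \<and>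
     (\<forall>t. I t \<in> F t \<rightarrow>\<^sub>M N) \<and> (\<forall>t. U t \<in> history M N I SU U t \<rightarrow>\<^sub>M SU) \<and>
     markov_transitions M (history_action M N I SU U) (restrict_space N St) K I U"

end

theory Submission
  imports Defs
begin

text \<open>
  The kernel \<open>\<K>\<close> records what happens to the belief in one step: the belief \<open>\<mu>\<close> is pushed through
  the dynamics to the predicted law \<open>\<L>\<^sub>u\<mu>\<close>, a cell label \<open>k\<close> is drawn with its predicted
  probability \<open>p\<^sub>k(\<mu>, u)\<close>, and Bayes' rule turns the pair into the next belief \<open>\<Phi>\<^sub>k(\<mu>, u)\<close>. Hence
  the next information state is a function of the current one, the action and the next label, and the
  label is the only fresh randomness. The proof makes this precise with conditional laws
  (\<open>cond_law\<close>): the kernel \<open>\<kappa>\<close> is the conditional law of \<open>Z\<close> given \<open>F\<close> if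
  \<open>P(B \<inter> {Z \<in> C}) = E[1\<^sub>B \<kappa>(C)]\<close> for all \<open>B \<in> F\<close>. The one tool for such kernels is
  disintegration (\<open>nn_integral_cond_law\<close>): \<open>E f(\<omega>, Z) = E (\<integral> f(\<omega>, z) \<kappa>\<^sub>\<omega>(dz))\<close> whenever \<open>f\<close> is
  \<open>F\<close>-measurable in \<open>\<omega>\<close>.

  \<^item> The noise pair at time \<open>t + 1\<close> is independent of the past, that is, of \<open>X\<^sub>0\<close> and the noises up to time
    \<open>t\<close>; its conditional law given the past is therefore constant (\<open>cond_law_noise\<close>). The history
    \<open>\<H>\<^sub>t\<close> lies in the past, because actions are functions of the history. Disintegrating over the
    noise gives \<open>P(B \<inter> {X\<^sub>t\<^sub>+\<^sub>1 \<in> C}) = E[1\<^sub>B Q(C | X\<^sub>t, U\<^sub>t)]\<close> for \<open>B \<in> \<H>\<^sub>t\<close>.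
  \<^item> Given \<open>\<H>\<^sub>t\<close>, the law of \<open>X\<^sub>t\<close> is \<open>\<pi>\<^sub>t\<close> and \<open>U\<^sub>t\<close> is known. A second disintegration, now over
    \<open>X\<^sub>t\<close>, shows that the law of \<open>X\<^sub>t\<^sub>+\<^sub>1\<close> given \<open>\<H>\<^sub>t\<close> is the prediction \<open>\<L>\<^sub>u\<pi>\<^sub>t\<close> at
    \<open>u = U\<^sub>t\<close> (\<open>cond_law_predict\<close>).
  \<^item> On the event \<open>{Y\<^sub>t\<^sub>+\<^sub>1 = k}\<close> the history \<open>\<H>\<^sub>t\<^sub>+\<^sub>1\<close> contains no events beyond those of
    \<open>\<H>\<^sub>t\<close>. Together with \<open>p\<^sub>k(\<mu>, u) \<Phi>\<^sub>k(\<mu>, u)(C) = (\<L>\<^sub>u\<mu>)(C \<inter> O\<^sub>k)\<close>, which also holds when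
    \<open>p\<^sub>k = 0\<close>, this identifies the law of \<open>X\<^sub>t\<^sub>+\<^sub>1\<close> given \<open>\<H>\<^sub>t\<^sub>+\<^sub>1\<close> as \<open>\<Phi>\<^sub>k(\<pi>\<^sub>t, U\<^sub>t)\<close> at
    \<open>k = Y\<^sub>t\<^sub>+\<^sub>1\<close> (\<open>cond_law_filter_update\<close>). Conditional laws being unique up to null sets,
    \<open>\<pi>\<^sub>t\<^sub>+\<^sub>1\<close> agrees with this filter update.
  \<^item> So \<open>I\<^sub>t\<^sub>+\<^sub>1 \<in> D\<close> is, up to a null set, the disjoint union over \<open>k\<close> of the events
    \<open>{Y\<^sub>t\<^sub>+\<^sub>1 = k}\<close> intersected with the \<open>\<H>\<^sub>t\<close>-measurable events
    \<open>{(k, \<Phi>\<^sub>k(\<pi>\<^sub>t, U\<^sub>t)) \<in> D}\<close>, and \<open>{Y\<^sub>t\<^sub>+\<^sub>1 = k}\<close> has conditional probability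
    \<open>p\<^sub>k(\<pi>\<^sub>t, U\<^sub>t)\<close>. This is the transition formula (\<open>info_transition\<close>).

  Conditioning on the information states and actions is no coarser than conditioning on \<open>\<H>\<^sub>t\<close>: the label
  is a component of \<open>I\<^sub>s\<close>, and \<open>\<pi>\<^sub>s\<close> and \<open>U\<^sub>t\<close> are functions of the history. The two
  \<open>\<sigma>\<close>-fields coincide (\<open>sets_info_history_action\<close>), which gives the second formula and the
  controlled Markov property.
\<close>

section \<open>Conditional laws and disintegration\<close>

text \<open>
  The defining identity tests a regular conditional law against events, so no null sets enter; it is what
  the independence and disintegration arguments produce and consume.
\<close>

definition cond_law ::
  "'w measure \<Rightarrow> 'w measure \<Rightarrow> 'a measure \<Rightarrow> ('w \<Rightarrow> 'a) \<Rightarrow> ('w \<Rightarrow> 'a measure) \<Rightarrow> bool" where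
  "cond_law M F S Z \<kappa> \<longleftrightarrow>
     \<kappa> \<in> F \<rightarrow>\<^sub>M prob_algebra S \<and> Z \<in> M \<rightarrow>\<^sub>M S \<and>
     (\<forall>B\<in>sets F. \<forall>C\<in>sets S.
        emeasure M (B \<inter> {\<omega> \<in> space M. Z \<omega> \<in> C}) = (\<integral>\<^sup>+ \<omega>. indicator B \<omega> * emeasure (\<kappa> \<omega>) C \<partial>M))"

lemma cond_lawD:
  assumes "cond_law M F S Z \<kappa>"
  shows "\<kappa> \<in> F \<rightarrow>\<^sub>M prob_algebra S" "Z \<in> M \<rightarrow>\<^sub>M S"
    "\<And>B C. B \<in> sets F \<Longrightarrow> C \<in> sets S \<Longrightarrow>
       emeasure M (B \<inter> {\<omega> \<in> space M. Z \<omega> \<in> C}) = (\<integral>\<^sup>+ \<omega>. indicator B \<omega> * emeasure (\<kappa> \<omega>) C \<partial>M)"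
  using assms unfolding cond_law_def by auto

lemma subalgebra_prob_space_sigma_finite:
  assumes "prob_space M" "subalgebra M F"
  shows "sigma_finite_subalgebra M F"
  by (intro finite_measure_subalgebra_is_sigma_finite finite_measure_subalgebra.intro
      finite_measure_subalgebra_axioms.intro prob_space.finite_measure assms)

lemma measurable_emeasure_prob_algebra [measurable]:
  "C \<in> sets S \<Longrightarrow> (\<lambda>\<mu>. emeasure \<mu> C) \<in> borel_measurable (prob_algebra S)"
  unfolding prob_algebra_def by (intro measurable_restrict_space1) measurable

lemma prob_algebra_emeasure_eq_measure:
  assumes "\<mu> \<in> space (prob_algebra S)"
  shows "emeasure \<mu> C = ennreal (measure \<mu> C)"
  using assms finite_measure.emeasure_eq_measure prob_space.finite_measure
  by (fastforce simp: space_prob_algebra)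

lemma prob_algebra_measure_le_1:
  assumes "\<mu> \<in> space (prob_algebra S)"
  shows "measure \<mu> C \<le> 1"
  using assms prob_space.prob_le_1 by (auto simp: space_prob_algebra)

text \<open>
  Values in \<open>[0, 1]\<close> make \<open>g\<close> integrable, so the event identity can be passed from the extended
  nonnegative integral, where it is produced, to the real conditional expectation.
\<close>

lemma real_cond_exp_indicator_eqI:
  assumes M: "prob_space M" and F: "subalgebra M F" and E: "E \<in> sets M"
    and g: "g \<in> borel_measurable F" and g01: "\<And>\<omega>. \<omega> \<in> space M \<Longrightarrow> 0 \<le> g \<omega> \<and> g \<omega> \<le> 1"
    and eq: "\<And>B. B \<in> sets F \<Longrightarrow>
      emeasure M (B \<inter> E) = (\<integral>\<^sup>+ \<omega>. indicator B \<omega> * ennreal (g \<omega>) \<partial>M)"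
  shows "AE \<omega> in M. real_cond_exp M F (indicator E) \<omega> = g \<omega>"
proof -
  interpret prob_space M by fact
  interpret sigma_finite_subalgebra M F
    by (rule subalgebra_prob_space_sigma_finite[OF M F])
  have gM[measurable]: "g \<in> borel_measurable M"
    using measurable_from_subalg[OF F g] .
  show ?thesis
  proof (rule real_cond_exp_charact)
    show "integrable M (indicator E :: _ \<Rightarrow> real)" using E by (simp add: less_top[symmetric])
    show "integrable M g"
      by (rule integrable_const_bound[where B=1]) (use g01 in auto)
    fix B assume B: "B \<in> sets F"
    then have BM[measurable]: "B \<in> sets M" using F by (auto simp: subalgebra_def)
    have "(LINT \<omega>:B|M. g \<omega>) = enn2real (\<integral>\<^sup>+ \<omega>. ennreal (indicator B \<omega> * g \<omega>) \<partial>M)"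
      unfolding set_lebesgue_integral_def real_scaleR_def
      by (rule integral_eq_nn_integral) (use g01 in \<open>auto simp: indicator_def\<close>)
    also have "(\<integral>\<^sup>+ \<omega>. ennreal (indicator B \<omega> * g \<omega>) \<partial>M) = emeasure M (B \<inter> E)"
      unfolding eq[OF B] by (rule nn_integral_cong) (auto simp: indicator_def)
    finally show "(LINT \<omega>:B|M. indicator E \<omega>) = (LINT \<omega>:B|M. g \<omega>)"
      using E by (simp add: set_lebesgue_integral_def measure_def indicator_inter_arith[symmetric] Int_ac)
  qed fact
qed

text \<open>
  By this passage a kernel that is specified only up to null sets, as the beliefs are, becomes a conditional
  law.
\<close>

lemma emeasure_Int_eq_integral_cond_exp:
  assumes M: "prob_space M" and F: "subalgebra M F" and E: "E \<in> sets M"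
    and g: "g \<in> borel_measurable M" and g0: "\<And>\<omega>. \<omega> \<in> space M \<Longrightarrow> 0 \<le> g \<omega> \<and> g \<omega> \<le> 1"
    and ae: "AE \<omega> in M. g \<omega> = real_cond_exp M F (indicator E) \<omega>"
    and B: "B \<in> sets F"
  shows "emeasure M (B \<inter> E) = (\<integral>\<^sup>+ \<omega>. indicator B \<omega> * ennreal (g \<omega>) \<partial>M)"
proof -
  interpret prob_space M by fact
  interpret sigma_finite_subalgebra M F
    by (rule subalgebra_prob_space_sigma_finite[OF M F])
  note [measurable] = g
  have BM[measurable]: "B \<in> sets M" using F B by (auto simp: subalgebra_def)
  have E_int: "integrable M (indicator E :: _ \<Rightarrow> real)" using E by (simp add: less_top[symmetric])
  have "measure M (B \<inter> E) = (LINT \<omega>:B|M. indicator E \<omega>)"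
    using E by (simp add: set_lebesgue_integral_def indicator_inter_arith[symmetric] Int_ac)
  also have "\<dots> = (LINT \<omega>:B|M. real_cond_exp M F (indicator E) \<omega>)"
    by (rule real_cond_exp_intA[OF E_int B])
  also have "\<dots> = (LINT \<omega>:B|M. g \<omega>)"
    unfolding set_lebesgue_integral_def
    by (rule integral_cong_AE) (use ae in auto)
  finally have "emeasure M (B \<inter> E) = ennreal (\<integral>\<omega>. indicator B \<omega> * g \<omega> \<partial>M)"
    by (simp add: emeasure_eq_measure set_lebesgue_integral_def)
  also have "\<dots> = (\<integral>\<^sup>+ \<omega>. ennreal (indicator B \<omega> * g \<omega>) \<partial>M)"
    by (rule nn_integral_eq_integral[symmetric])
       (use g0 in \<open>auto simp: indicator_def intro!: integrable_const_bound[where B=1]\<close>)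
  also have "\<dots> = (\<integral>\<^sup>+ \<omega>. indicator B \<omega> * ennreal (g \<omega>) \<partial>M)"
    by (rule nn_integral_cong) (auto simp: indicator_def)
  finally show ?thesis .
qed

lemma cond_law_kernel_space:
  assumes F: "subalgebra M F" and "cond_law M F S Z \<kappa>" "\<omega> \<in> space M"
  shows "\<kappa> \<omega> \<in> space (prob_algebra S)"
  using measurable_space[OF cond_lawD(1)[OF assms(2)]] assms by (simp add: subalgebra_def)

lemma cond_law_imp_cond_probability:
  assumes M: "prob_space M" and F: "subalgebra M F" and law: "cond_law M F S Z \<kappa>"
    and C[measurable]: "C \<in> sets S"
  shows "AE \<omega> in M. cond_probability M F Z C \<omega> = measure (\<kappa> \<omega>) C"
  unfolding cond_probability_def
proof (rule real_cond_exp_indicator_eqI[OF M F])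
  note [measurable] = cond_lawD(1,2)[OF law]
  show "{\<omega> \<in> space M. Z \<omega> \<in> C} \<in> sets M" by measurable
  show "(\<lambda>\<omega>. measure (\<kappa> \<omega>) C) \<in> borel_measurable F" by measurable
  show "0 \<le> measure (\<kappa> \<omega>) C \<and> measure (\<kappa> \<omega>) C \<le> 1" if "\<omega> \<in> space M" for \<omega>
    using prob_algebra_measure_le_1 cond_law_kernel_space[OF F law that] by auto
  show "emeasure M (B \<inter> {\<omega> \<in> space M. Z \<omega> \<in> C}) =
      (\<integral>\<^sup>+ \<omega>. indicator B \<omega> * ennreal (measure (\<kappa> \<omega>) C) \<partial>M)" if "B \<in> sets F" for B
    unfolding cond_lawD(3)[OF law that C]
    by (intro nn_integral_cong)
       (simp add: prob_algebra_emeasure_eq_measure[OF cond_law_kernel_space[OF F law]])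
qed

lemma cond_probability_imp_cond_law:
  assumes M: "prob_space M" and F: "subalgebra M F"
    and \<kappa>: "\<kappa> \<in> F \<rightarrow>\<^sub>M prob_algebra S" and Z: "Z \<in> M \<rightarrow>\<^sub>M S"
    and ae: "\<And>C. C \<in> sets S \<Longrightarrow> AE \<omega> in M. measure (\<kappa> \<omega>) C = cond_probability M F Z C \<omega>"
  shows "cond_law M F S Z \<kappa>"
  unfolding cond_law_def
proof (intro conjI ballI \<kappa> Z)
  fix B C assume B: "B \<in> sets F" and C[measurable]: "C \<in> sets S"
  note [measurable] = \<kappa> Z
  have \<kappa>S: "\<kappa> \<omega> \<in> space (prob_algebra S)" if "\<omega> \<in> space M" for \<omega>
    using measurable_space[OF \<kappa>] that F by (simp add: subalgebra_def)
  have "emeasure M (B \<inter> {\<omega> \<in> space M. Z \<omega> \<in> C}) =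
      (\<integral>\<^sup>+ \<omega>. indicator B \<omega> * ennreal (measure (\<kappa> \<omega>) C) \<partial>M)"
  proof (rule emeasure_Int_eq_integral_cond_exp[OF M F _ _ _ _ B])
    show "(\<lambda>\<omega>. measure (\<kappa> \<omega>) C) \<in> borel_measurable M"
      by (rule measurable_from_subalg[OF F]) measurable
    show "0 \<le> measure (\<kappa> \<omega>) C \<and> measure (\<kappa> \<omega>) C \<le> 1" if "\<omega> \<in> space M" for \<omega>
      using prob_algebra_measure_le_1 \<kappa>S[OF that] by auto
  qed (use ae[OF C] in \<open>auto simp: cond_probability_def\<close>)
  also have "\<dots> = (\<integral>\<^sup>+ \<omega>. indicator B \<omega> * emeasure (\<kappa> \<omega>) C \<partial>M)"
    by (intro nn_integral_cong) (simp add: prob_algebra_emeasure_eq_measure[OF \<kappa>S])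
  finally show "emeasure M (B \<inter> {\<omega> \<in> space M. Z \<omega> \<in> C}) =
      (\<integral>\<^sup>+ \<omega>. indicator B \<omega> * emeasure (\<kappa> \<omega>) C \<partial>M)" .
qed

text \<open>
  Both sides are integrals of \<open>f\<close> against measures on \<open>F \<Otimes> S\<close>: the joint law of \<open>(\<omega>, Z)\<close>, and
  the law that draws \<open>\<omega>\<close> first and then \<open>z\<close> from \<open>\<kappa> \<omega>\<close>. On rectangles they agree by the definition
  of a conditional law, and rectangles generate.
\<close>

lemma nn_integral_cond_law:
  assumes M: "prob_space M" and F: "subalgebra M F" and law: "cond_law M F S Z \<kappa>"
    and f: "(\<lambda>(\<omega>, z). f \<omega> z) \<in> borel_measurable (F \<Otimes>\<^sub>M S)"
  shows "(\<integral>\<^sup>+ \<omega>. f \<omega> (Z \<omega>) \<partial>M) = (\<integral>\<^sup>+ \<omega>. (\<integral>\<^sup>+ z. f \<omega> z \<partial>\<kappa> \<omega>) \<partial>M)"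
proof -
  interpret prob_space M by fact
  have spF: "space F = space M" using F by (simp add: subalgebra_def)
  note \<kappa>[measurable] = cond_lawD(1)[OF law] and Z[measurable] = cond_lawD(2)[OF law] and f[measurable]
  have id: "(\<lambda>\<omega>. \<omega>) \<in> M \<rightarrow>\<^sub>M F" using measurable_from_subalg[OF F measurable_ident] by (simp add: id_def)
  have [measurable]: "(\<lambda>\<omega>. (\<omega>, Z \<omega>)) \<in> M \<rightarrow>\<^sub>M F \<Otimes>\<^sub>M S" using id by measurable
  define K where "K = (\<lambda>\<omega>. distr (\<kappa> \<omega>) (F \<Otimes>\<^sub>M S) (Pair \<omega>))"
  have K[measurable]: "K \<in> F \<rightarrow>\<^sub>M prob_algebra (F \<Otimes>\<^sub>M S)" unfolding K_def by measurable
  let ?R = "restr_to_subalg M F"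
  have KR: "K \<in> ?R \<rightarrow>\<^sub>M prob_algebra (F \<Otimes>\<^sub>M S)" by (rule measurable_in_subalg[OF F K])
  have R: "?R \<in> space (prob_algebra ?R)"
    using prob_space_restr_to_subalg[OF F M] by (simp add: space_prob_algebra)
  have \<kappa>S: "\<kappa> \<omega> \<in> space (prob_algebra S)" if "\<omega> \<in> space M" for \<omega>
    using cond_law_kernel_space[OF F law that] .
  have sets\<kappa>: "sets (\<kappa> \<omega>) = sets S" if "\<omega> \<in> space M" for \<omega>
    using \<kappa>S[OF that] by (simp add: space_prob_algebra)
  have sp\<kappa>: "space (\<kappa> \<omega>) = space S" if "\<omega> \<in> space M" for \<omega>
    using sets\<kappa>[OF that] by (rule sets_eq_imp_space_eq)
  have Pair: "Pair \<omega> \<in> \<kappa> \<omega> \<rightarrow>\<^sub>M F \<Otimes>\<^sub>M S" if "\<omega> \<in> space M" for \<omega>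
    unfolding measurable_cong_sets[OF sets\<kappa>[OF that] refl] by (rule measurable_Pair1') (simp add: that spF)
  have eq: "distr M (F \<Otimes>\<^sub>M S) (\<lambda>\<omega>. (\<omega>, Z \<omega>)) = ?R \<bind> K"
  proof (rule measure_eqI_generator_eq[OF Int_stable_pair_measure_generator])
    show "{a \<times> b |a b. a \<in> sets F \<and> b \<in> sets S} \<subseteq> Pow (space F \<times> space S)"
      by (rule pair_measure_closed)
    fix X assume "X \<in> {a \<times> b |a b. a \<in> sets F \<and> b \<in> sets S}"
    then obtain B C where X: "X = B \<times> C" and B: "B \<in> sets F" and C: "C \<in> sets S" by auto
    have "emeasure (distr M (F \<Otimes>\<^sub>M S) (\<lambda>\<omega>. (\<omega>, Z \<omega>))) X
        = emeasure M (B \<inter> {\<omega> \<in> space M. Z \<omega> \<in> C})"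
      using B C sets.sets_into_space[OF B]
      by (subst emeasure_distr) (auto simp: X intro!: arg_cong[where f="emeasure M"])
    also have "\<dots> = (\<integral>\<^sup>+ \<omega>. indicator B \<omega> * emeasure (\<kappa> \<omega>) C \<partial>M)"
      by (rule cond_lawD(3)[OF law B C])
    also have "\<dots> = (\<integral>\<^sup>+ \<omega>. emeasure (K \<omega>) X \<partial>M)"
    proof (rule nn_integral_cong)
      fix \<omega> assume \<omega>: "\<omega> \<in> space M"
      have "Pair \<omega> -` (B \<times> C) \<inter> space (\<kappa> \<omega>) = (if \<omega> \<in> B then C else {})"
        using sets.sets_into_space[OF C] sp\<kappa>[OF \<omega>] by auto
      moreover have "emeasure (K \<omega>) X = emeasure (\<kappa> \<omega>) (Pair \<omega> -` (B \<times> C) \<inter> space (\<kappa> \<omega>))"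
        unfolding K_def X by (rule emeasure_distr[OF Pair[OF \<omega>] pair_measureI[OF B C]])
      ultimately show "indicator B \<omega> * emeasure (\<kappa> \<omega>) C = emeasure (K \<omega>) X"
        by (cases "\<omega> \<in> B") simp_all
    qed
    also have "\<dots> = (\<integral>\<^sup>+ \<omega>. emeasure (K \<omega>) X \<partial>?R)"
      by (rule nn_integral_subalgebra2[symmetric, OF F])
         (rule measurable_compose[OF K measurable_emeasure_prob_algebra], simp add: X B C)
    also have "\<dots> = emeasure (?R \<bind> K) X"
      by (rule emeasure_bind_prob_algebra[symmetric, OF R KR]) (use B C X in auto)
    finally show "emeasure (distr M (F \<Otimes>\<^sub>M S) (\<lambda>\<omega>. (\<omega>, Z \<omega>))) X = emeasure (?R \<bind> K) X" .
  next
    show "sets (distr M (F \<Otimes>\<^sub>M S) (\<lambda>\<omega>. (\<omega>, Z \<omega>))) =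
        sigma_sets (space F \<times> space S) {a \<times> b |a b. a \<in> sets F \<and> b \<in> sets S}"
      by (simp add: sets_pair_measure)
    show "sets (?R \<bind> K) = sigma_sets (space F \<times> space S) {a \<times> b |a b. a \<in> sets F \<and> b \<in> sets S}"
      by (simp add: sets_bind'[OF R KR] sets_pair_measure)
    show "range (\<lambda>i::nat. space F \<times> space S) \<subseteq> {a \<times> b |a b. a \<in> sets F \<and> b \<in> sets S}" by auto
    show "(\<Union>i::nat. space F \<times> space S) = space F \<times> space S" by auto
    show "emeasure (distr M (F \<Otimes>\<^sub>M S) (\<lambda>\<omega>. (\<omega>, Z \<omega>))) (space F \<times> space S) \<noteq> \<infinity>"
      by (subst emeasure_distr) auto
  qed
  let ?f = "\<lambda>(\<omega>, z). f \<omega> z"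
  have "(\<integral>\<^sup>+ \<omega>. f \<omega> (Z \<omega>) \<partial>M) = (\<integral>\<^sup>+ p. ?f p \<partial>distr M (F \<Otimes>\<^sub>M S) (\<lambda>\<omega>. (\<omega>, Z \<omega>)))"
    by (subst nn_integral_distr) auto
  also have "\<dots> = (\<integral>\<^sup>+ \<omega>. (\<integral>\<^sup>+ p. ?f p \<partial>K \<omega>) \<partial>?R)"
    unfolding eq by (rule nn_integral_bind[OF f measurable_prob_algebraD[OF KR]])
  also have "\<dots> = (\<integral>\<^sup>+ \<omega>. (\<integral>\<^sup>+ p. ?f p \<partial>K \<omega>) \<partial>M)"
    by (rule nn_integral_subalgebra2[OF F])
       (rule nn_integral_measurable_subprob_algebra2[OF _ measurable_prob_algebraD[OF K]], simp)
  also have "\<dots> = (\<integral>\<^sup>+ \<omega>. (\<integral>\<^sup>+ z. f \<omega> z \<partial>\<kappa> \<omega>) \<partial>M)"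
    unfolding K_def by (intro nn_integral_cong, subst nn_integral_distr[OF Pair]) (auto simp: f)
  finally show ?thesis .
qed

section \<open>Filter operators and the information kernel\<close>

text \<open>
  The deterministic part of filtering, with beliefs and actions as points of their spaces and no random
  process yet. The measure \<open>\<rho> k\<close> is the belief adopted after an observation of predicted probability zero.
\<close>

locale filter_model =
  fixes SX :: "'x measure" and SU :: "'u measure" and Q :: "'x \<Rightarrow> 'u \<Rightarrow> 'x measure"
    and Oc :: "nat \<Rightarrow> 'x set" and r :: nat and \<rho> :: "nat \<Rightarrow> 'x measure"
  assumes kernel: "(\<lambda>(x, u). Q x u) \<in> SX \<Otimes>\<^sub>M SU \<rightarrow>\<^sub>M prob_algebra SX"
    and cell_sets: "\<And>k. k \<in> {1..r + 1} \<Longrightarrow> Oc k \<in> sets SX"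
    and cell_disj: "disjoint_family_on Oc {1..r + 1}"
    and cell_cover: "(\<Union>k\<in>{1..r + 1}. Oc k) = space SX"
    and restart: "\<And>k. k \<in> obs_labels Oc r \<Longrightarrow> \<rho> k \<in> space (prob_algebra SX)"
      "\<And>k. k \<in> obs_labels Oc r \<Longrightarrow> measure (\<rho> k) (Oc k) = 1"
begin

abbreviation "PX \<equiv> prob_algebra SX"
abbreviation "labels \<equiv> obs_labels Oc r"
abbreviation "pred \<mu> u \<equiv> predict SX Q u \<mu>"
abbreviation "p k \<mu> u \<equiv> obs_prob SX Q Oc k \<mu> u"
abbreviation "\<Phi> k \<mu> u \<equiv> filter_update SX Q Oc \<rho> k \<mu> u"

lemma finite_labels [simp, intro]: "finite labels"
  by (simp add: obs_labels_def)

lemma label_cell_sets [measurable]: "k \<in> labels \<Longrightarrow> Oc k \<in> sets SX"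
  using cell_sets by (auto simp: obs_labels_def)

lemma label_cells_disjoint: "disjoint_family_on Oc labels"
  using cell_disj by (rule disjoint_family_on_mono[rotated]) (auto simp: obs_labels_def)

lemma label_cells_cover: "(\<Union>k\<in>labels. Oc k) = space SX"
  unfolding cell_cover[symmetric] by (auto simp: obs_labels_def)

lemma kernel_section: "u \<in> space SU \<Longrightarrow> (\<lambda>x. Q x u) \<in> SX \<rightarrow>\<^sub>M PX"
  using measurable_compose[OF measurable_Pair2' kernel] by simp

text \<open>
  Identifying the prediction with the Kleisli composition of the Giry monad supplies countable additivity
  and joint measurability in the belief and the action.
\<close>

lemma predict_eq_bind:
  assumes "\<mu> \<in> space PX" "u \<in> space SU"
  shows "pred \<mu> u = \<mu> \<bind> (\<lambda>x. Q x u)"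
proof -
  have s: "sets (\<mu> \<bind> (\<lambda>x. Q x u)) = sets SX"
    by (rule sets_bind'[OF assms(1) kernel_section[OF assms(2)]])
  have "pred \<mu> u = measure_of (space SX) (sets SX) (emeasure (\<mu> \<bind> (\<lambda>x. Q x u)))"
    unfolding predict_def
    by (rule measure_of_eq[OF sets.space_closed])
       (simp add: sets.sigma_sets_eq emeasure_bind_prob_algebra[OF assms(1) kernel_section[OF assms(2)]])
  also have "\<dots> = \<mu> \<bind> (\<lambda>x. Q x u)"
    using measure_of_of_measure[of "\<mu> \<bind> (\<lambda>x. Q x u)"] s sets_eq_imp_space_eq[OF s] by simp
  finally show ?thesis .
qed

lemma measurable_predict: "(\<lambda>(\<mu>, u). pred \<mu> u) \<in> PX \<Otimes>\<^sub>M SU \<rightarrow>\<^sub>M PX"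
proof -
  note kernel [measurable]
  have "(\<lambda>z. (snd z, snd (fst z))) \<in> (PX \<Otimes>\<^sub>M SU) \<Otimes>\<^sub>M SX \<rightarrow>\<^sub>M SX \<Otimes>\<^sub>M SU" by measurable
  from measurable_compose[OF this kernel]
  have "(\<lambda>(z, x). Q x (snd z)) \<in> (PX \<Otimes>\<^sub>M SU) \<Otimes>\<^sub>M SX \<rightarrow>\<^sub>M PX" by (simp add: case_prod_beta')
  from measurable_bind_prob_space2[OF measurable_fst this]
  have "(\<lambda>z. fst z \<bind> (\<lambda>x. Q x (snd z))) \<in> PX \<Otimes>\<^sub>M SU \<rightarrow>\<^sub>M PX" .
  also have "?this \<longleftrightarrow> ?thesis"
    by (intro measurable_cong) (auto simp: space_pair_measure predict_eq_bind)
  finally show ?thesis .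
qed

lemma predict_in_space:
  "\<mu> \<in> space PX \<Longrightarrow> u \<in> space SU \<Longrightarrow> pred \<mu> u \<in> space PX"
  using measurable_space[OF measurable_predict, of "(\<mu>, u)"] by (simp add: space_pair_measure)

lemma emeasure_predict:
  assumes "\<mu> \<in> space PX" "u \<in> space SU" "C \<in> sets SX"
  shows "emeasure (pred \<mu> u) C = (\<integral>\<^sup>+ x. emeasure (Q x u) C \<partial>\<mu>)"
  unfolding predict_eq_bind[OF assms(1,2)]
  by (rule emeasure_bind_prob_algebra[OF assms(1) kernel_section[OF assms(2)] assms(3)])

lemma emeasure_pred_cell:
  assumes "\<mu> \<in> space PX" "u \<in> space SU"
  shows "emeasure (pred \<mu> u) (Oc k) = ennreal (p k \<mu> u)"
  unfolding obs_prob_def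
  using prob_algebra_emeasure_eq_measure[OF predict_in_space[OF assms]] .

text \<open>
  The restriction to a cell is the measure with density \<open>1\<^bsub>O\<^sub>k\<^esub>\<close>, which shows that the set function is
  countably additive.
\<close>

lemma emeasure_predict_on:
  assumes "\<mu> \<in> space PX" "u \<in> space SU" "k \<in> labels" "C \<in> sets SX"
  shows "emeasure (predict_on SX Q Oc u k \<mu>) C = emeasure (pred \<mu> u) (C \<inter> Oc k)"
proof -
  have s: "sets (pred \<mu> u) = sets SX"
    using predict_in_space[OF assms(1,2)] by (simp add: space_prob_algebra)
  have O: "Oc k \<in> sets (pred \<mu> u)" using assms(3) by (simp add: s label_cell_sets)
  have r: "emeasure (density (pred \<mu> u) (indicator (Oc k))) D = emeasure (pred \<mu> u) (D \<inter> Oc k)"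
    if "D \<in> sets SX" for D
    using that O by (subst emeasure_density)
      (simp_all add: s indicator_inter_arith[symmetric] Int_ac borel_measurable_indicator)
  have "predict_on SX Q Oc u k \<mu> = measure_of (space SX) (sets SX)
      (emeasure (density (pred \<mu> u) (indicator (Oc k))))"
    unfolding predict_on_def
    by (rule measure_of_eq[OF sets.space_closed]) (simp add: sets.sigma_sets_eq r)
  also have "\<dots> = density (pred \<mu> u) (indicator (Oc k))"
    using measure_of_of_measure[of "density (pred \<mu> u) (indicator (Oc k))"] s
      sets_eq_imp_space_eq[OF s] by simp
  finally show ?thesis using r[OF assms(4)] by simp
qed

lemma sets_filter_update: "k \<in> labels \<Longrightarrow> sets (\<Phi> k \<mu> u) = sets SX"
  using restart(1) by (simp add: filter_update_def predict_on_def space_prob_algebra)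

lemma emeasure_filter_update:
  assumes "\<mu> \<in> space PX" "u \<in> space SU" "k \<in> labels" "C \<in> sets SX"
  shows "emeasure (\<Phi> k \<mu> u) C =
    (if p k \<mu> u > 0 then (1 / ennreal (p k \<mu> u)) * emeasure (pred \<mu> u) (C \<inter> Oc k)
     else emeasure (\<rho> k) C)"
  by (simp add: filter_update_def emeasure_predict_on[OF assms])

text \<open>
  Bayes' rule with the denominator cleared. If the cell has predicted probability zero, both sides
  vanish, whatever \<open>\<rho> k\<close> is; this is why the identity can be integrated without case distinction.
\<close>

lemma obs_prob_mult_filter_update:
  assumes "\<mu> \<in> space PX" "u \<in> space SU" "k \<in> labels" "C \<in> sets SX"
  shows "ennreal (p k \<mu> u) * emeasure (\<Phi> k \<mu> u) C = emeasure (pred \<mu> u) (C \<inter> Oc k)"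
proof (cases "p k \<mu> u > 0")
  case True
  then have "ennreal (p k \<mu> u) * (1 / ennreal (p k \<mu> u)) = 1"
    by (simp add: ennreal_times_divide divide_ennreal)
  with True show ?thesis
    by (simp add: emeasure_filter_update[OF assms] mult.assoc[symmetric])
next
  case False
  then have 0: "p k \<mu> u = 0" by (simp add: obs_prob_def zero_less_measure_iff)
  have s: "sets (pred \<mu> u) = sets SX"
    using predict_in_space[OF assms(1,2)] by (simp add: space_prob_algebra)
  have "emeasure (pred \<mu> u) (C \<inter> Oc k) \<le> emeasure (pred \<mu> u) (Oc k)"
    using assms(3) by (intro emeasure_mono) (simp_all add: s label_cell_sets)
  then show ?thesis using 0 by (simp add: emeasure_pred_cell[OF assms(1,2)])
qed

lemma emeasure_filter_update_cell:
  assumes "\<mu> \<in> space PX" "u \<in> space SU" "k \<in> labels"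
  shows "emeasure (\<Phi> k \<mu> u) (Oc k) = 1"
proof (cases "p k \<mu> u > 0")
  case True
  then show ?thesis
    using assms by (simp add: emeasure_filter_update label_cell_sets emeasure_pred_cell
        divide_ennreal ennreal_mult[symmetric] ennreal_times_divide mult.commute)
next
  case False
  then show ?thesis
    using assms restart[of k] prob_algebra_emeasure_eq_measure[of "\<rho> k" SX "Oc k"]
    by (simp add: filter_update_def)
qed

lemma filter_update_in_space:
  assumes "\<mu> \<in> space PX" "u \<in> space SU" "k \<in> labels"
  shows "\<Phi> k \<mu> u \<in> space PX"
proof -
  have sp: "space (\<Phi> k \<mu> u) = space SX"
    using sets_filter_update[OF assms(3)] by (rule sets_eq_imp_space_eq)
  have "emeasure (\<Phi> k \<mu> u) (space SX) = emeasure (\<Phi> k \<mu> u) (Oc k)"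
  proof (cases "p k \<mu> u > 0")
    case True
    have "space SX \<inter> Oc k = Oc k" using sets.sets_into_space[OF label_cell_sets[OF assms(3)]] by auto
    with True assms show ?thesis by (simp add: emeasure_filter_update label_cell_sets)
  next
    case False
    with restart(1)[OF assms(3)] show ?thesis
      using emeasure_filter_update_cell[OF assms] in_space_prob_algebra[of "\<rho> k" SX]
      by (simp add: filter_update_def)
  qed
  then have "prob_space (\<Phi> k \<mu> u)"
    by (intro prob_spaceI) (simp add: sp emeasure_filter_update_cell[OF assms])
  then show ?thesis
    by (simp add: space_prob_algebra sets_filter_update[OF assms(3)])
qed

lemma measurable_obs_prob:
  "k \<in> labels \<Longrightarrow> (\<lambda>(\<mu>, u). p k \<mu> u) \<in> borel_measurable (PX \<Otimes>\<^sub>M SU)"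
  unfolding obs_prob_def case_prod_beta'
  by (rule measurable_compose[OF measurable_predict[unfolded case_prod_beta'] measurable_measure_prob_algebra])
     (rule label_cell_sets)

text \<open>
  The \<open>\<sigma>\<close>-field on beliefs is generated by the evaluations at measurable sets \<open>C\<close>, so it suffices
  that \<open>\<Phi>\<^sub>k(\<mu>, u)(C)\<close> is measurable, and this is a case distinction between measurable functions.
\<close>

lemma measurable_filter_update:
  assumes k: "k \<in> labels"
  shows "(\<lambda>(\<mu>, u). \<Phi> k \<mu> u) \<in> PX \<Otimes>\<^sub>M SU \<rightarrow>\<^sub>M PX"
proof (rule measurable_prob_algebraI)
  have \<Phi>: "(\<lambda>(\<mu>, u). \<Phi> k \<mu> u) z \<in> space PX" if "z \<in> space (PX \<Otimes>\<^sub>M SU)" for z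
    using that filter_update_in_space[OF _ _ k] by (auto simp: space_pair_measure)
  then show prob: "prob_space ((\<lambda>(\<mu>, u). \<Phi> k \<mu> u) z)" if "z \<in> space (PX \<Otimes>\<^sub>M SU)" for z
    using that by (auto simp: space_prob_algebra)
  show "(\<lambda>(\<mu>, u). \<Phi> k \<mu> u) \<in> PX \<Otimes>\<^sub>M SU \<rightarrow>\<^sub>M subprob_algebra SX"
  proof (rule measurable_subprob_algebra)
    show "subprob_space ((\<lambda>(\<mu>, u). \<Phi> k \<mu> u) z)" if "z \<in> space (PX \<Otimes>\<^sub>M SU)" for z
      by (rule prob_space_imp_subprob_space[OF prob[OF that]])
    show "sets ((\<lambda>(\<mu>, u). \<Phi> k \<mu> u) z) = sets SX" if "z \<in> space (PX \<Otimes>\<^sub>M SU)" for z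
      using \<Phi>[OF that] by (simp add: space_prob_algebra)
    fix C assume C: "C \<in> sets SX"
    have [measurable]: "(\<lambda>z. p k (fst z) (snd z)) \<in> borel_measurable (PX \<Otimes>\<^sub>M SU)"
      using measurable_obs_prob[OF k] by (simp add: case_prod_beta')
    have [measurable]: "(\<lambda>z. emeasure (pred (fst z) (snd z)) (C \<inter> Oc k)) \<in> borel_measurable (PX \<Otimes>\<^sub>M SU)"
      by (rule measurable_compose[OF measurable_predict[unfolded case_prod_beta']
            measurable_emeasure_prob_algebra]) (use C k label_cell_sets in auto)
    have "(\<lambda>z. if p k (fst z) (snd z) > 0
        then (1 / ennreal (p k (fst z) (snd z))) * emeasure (pred (fst z) (snd z)) (C \<inter> Oc k)
        else emeasure (\<rho> k) C) \<in> borel_measurable (PX \<Otimes>\<^sub>M SU)"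
      by measurable
    also have "?this \<longleftrightarrow>
        (\<lambda>z. emeasure ((\<lambda>(\<mu>, u). \<Phi> k \<mu> u) z) C) \<in> borel_measurable (PX \<Otimes>\<^sub>M SU)"
      by (intro measurable_cong)
         (auto simp: space_pair_measure emeasure_filter_update[OF _ _ k C])
    finally show "(\<lambda>z. emeasure ((\<lambda>(\<mu>, u). \<Phi> k \<mu> u) z) C) \<in> borel_measurable (PX \<Otimes>\<^sub>M SU)" .
  qed
qed

lemma sum_obs_prob:
  assumes "\<mu> \<in> space PX" "u \<in> space SU"
  shows "(\<Sum>k\<in>labels. p k \<mu> u) = 1"
proof -
  have P: "pred \<mu> u \<in> space PX" by (rule predict_in_space[OF assms])
  interpret P: prob_space "pred \<mu> u" using P by (simp add: space_prob_algebra)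
  have s: "sets (pred \<mu> u) = sets SX" using P by (simp add: space_prob_algebra)
  have "measure (pred \<mu> u) (\<Union>k\<in>labels. Oc k) = (\<Sum>k\<in>labels. p k \<mu> u)"
    unfolding obs_prob_def
    by (rule P.finite_measure_finite_Union) (auto simp: s label_cell_sets label_cells_disjoint)
  then show ?thesis
    using P.prob_space sets_eq_imp_space_eq[OF s] by (simp add: label_cells_cover)
qed

lemma beliefs_on_sets:
  assumes "k \<in> labels"
  shows "beliefs_on SX Oc k \<in> sets PX"
proof -
  have [measurable]: "Oc k \<in> sets SX" using assms by (rule label_cell_sets)
  show ?thesis unfolding beliefs_on_def by measurable
qed

lemma info_states_sets: "info_states SX Oc r \<in> sets (info_ambient SX Oc r)"
  unfolding info_states_def info_ambient_def label_space_def
  by (intro sets.finite_UN finite_labels pair_measureI beliefs_on_sets) auto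

lemma sets_info_space_subset: "sets (info_space SX Oc r) \<subseteq> sets (info_ambient SX Oc r)"
  unfolding info_space_def sets_restrict_space
  using sets.Int[OF info_states_sets] by auto

lemma space_info_space: "space (info_space SX Oc r) = info_states SX Oc r"
  unfolding info_space_def space_restrict_space
  using sets.sets_into_space[OF info_states_sets] by auto

lemma filter_update_info_state:
  assumes "\<mu> \<in> space PX" "u \<in> space SU" "k \<in> labels"
  shows "(k, \<Phi> k \<mu> u) \<in> info_states SX Oc r"
proof -
  have "\<Phi> k \<mu> u \<in> beliefs_on SX Oc k"
    unfolding beliefs_on_def measure_def
    by (simp add: filter_update_in_space[OF assms] emeasure_filter_update_cell[OF assms])
  with assms(3) show ?thesis unfolding info_states_def by blast
qed

lemma measurable_labelled_filter_update:
  assumes k: "k \<in> labels"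
  shows "(\<lambda>(\<mu>, u). (k, \<Phi> k \<mu> u)) \<in> PX \<Otimes>\<^sub>M SU \<rightarrow>\<^sub>M info_ambient SX Oc r"
proof -
  have [measurable]: "(\<lambda>z. \<Phi> k (fst z) (snd z)) \<in> PX \<Otimes>\<^sub>M SU \<rightarrow>\<^sub>M PX"
    using measurable_filter_update[OF k] by (simp add: case_prod_beta')
  have [simp]: "k \<in> space (label_space Oc r)" using k by (simp add: label_space_def)
  show ?thesis unfolding info_ambient_def case_prod_beta' by measurable
qed

lemma measurable_info_kernel:
  assumes D: "D \<in> sets (info_ambient SX Oc r)"
  shows "(\<lambda>(I, u). info_kernel SX Q Oc r \<rho> D I u)
    \<in> borel_measurable (info_ambient SX Oc r \<Otimes>\<^sub>M SU)"
  unfolding info_kernel_def case_prod_beta'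
proof (intro borel_measurable_sum borel_measurable_times)
  fix k assume k: "k \<in> labels"
  have m: "(\<lambda>z. (snd (fst z), snd z)) \<in> info_ambient SX Oc r \<Otimes>\<^sub>M SU \<rightarrow>\<^sub>M PX \<Otimes>\<^sub>M SU"
    unfolding info_ambient_def by measurable
  show "(\<lambda>z. p k (snd (fst z)) (snd z)) \<in> borel_measurable (info_ambient SX Oc r \<Otimes>\<^sub>M SU)"
    using measurable_compose[OF m measurable_obs_prob[OF k]] by (simp add: case_prod_beta')
  have "(\<lambda>z. (k, \<Phi> k (snd (fst z)) (snd z))) \<in>
      info_ambient SX Oc r \<Otimes>\<^sub>M SU \<rightarrow>\<^sub>M info_ambient SX Oc r"
    using measurable_compose[OF m measurable_labelled_filter_update[OF k]] by (simp add: case_prod_beta')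
  from measurable_compose[OF this borel_measurable_indicator[OF D]]
  show "(\<lambda>z. indicator D (k, \<Phi> k (snd (fst z)) (snd z)) :: real)
      \<in> borel_measurable (info_ambient SX Oc r \<Otimes>\<^sub>M SU)" .
qed

text \<open>
  The witness is the image of the label distribution \<open>k \<mapsto> p\<^sub>k(\<mu>, u)\<close> under
  \<open>k \<mapsto> (k, \<Phi>\<^sub>k(\<mu>, u))\<close>, which takes values in the information states.
\<close>

lemma info_kernel_is_probability:
  assumes \<mu>: "\<mu> \<in> space PX" and u: "u \<in> space SU"
  shows "\<exists>\<kappa>\<in>space (prob_algebra (info_space SX Oc r)).
    \<forall>D\<in>sets (info_space SX Oc r). info_kernel SX Q Oc r \<rho> D (j, \<mu>) u = measure \<kappa> D"
proof -
  let ?S = "info_space SX Oc r"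
  let ?w = "density (count_space labels) (\<lambda>k. ennreal (p k \<mu> u))"
  let ?h = "\<lambda>k. (k, \<Phi> k \<mu> u)"
  have p0: "0 \<le> p k \<mu> u" for k by (simp add: obs_prob_def)
  have h: "?h \<in> ?w \<rightarrow>\<^sub>M ?S"
    by (auto simp: measurable_def space_info_space filter_update_info_state[OF \<mu> u])
  have w: "emeasure ?w B = ennreal (\<Sum>k\<in>labels. p k \<mu> u * indicator B k)" if "B \<subseteq> labels" for B
  proof -
    have "emeasure ?w B = (\<Sum>k\<in>labels. ennreal (p k \<mu> u) * indicator B k)"
      using that by (subst emeasure_density) (simp_all add: nn_integral_count_space_finite)
    also have "\<dots> = (\<Sum>k\<in>labels. ennreal (p k \<mu> u * indicator B k))"
      by (rule sum.cong) (simp_all split: split_indicator)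
    also have "\<dots> = ennreal (\<Sum>k\<in>labels. p k \<mu> u * indicator B k)"
      using p0 by (intro sum_ennreal) simp
    finally show ?thesis .
  qed
  have meas: "emeasure (distr ?w ?S ?h) D = ennreal (info_kernel SX Q Oc r \<rho> D (j, \<mu>) u)"
    if D: "D \<in> sets ?S" for D
  proof -
    have "emeasure (distr ?w ?S ?h) D = emeasure ?w {k \<in> labels. ?h k \<in> D}"
      using D h by (subst emeasure_distr) (auto intro!: arg_cong[where f="emeasure ?w"])
    also have "\<dots> = ennreal (info_kernel SX Q Oc r \<rho> D (j, \<mu>) u)"
      unfolding info_kernel_def
      by (subst w) (auto intro!: arg_cong[where f=ennreal] sum.cong simp: indicator_def)
    finally show ?thesis .
  qed
  \<comment> \<open>The total mass of the label distribution is one because the cells cover the state space.\<close>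
  have "prob_space ?w"
    by (rule prob_spaceI) (simp add: w sum_obs_prob[OF \<mu> u])
  then have "distr ?w ?S ?h \<in> space (prob_algebra ?S)"
    using h by (simp add: space_prob_algebra prob_space.prob_space_distr)
  moreover have "info_kernel SX Q Oc r \<rho> D (j, \<mu>) u = measure (distr ?w ?S ?h) D"
    if "D \<in> sets ?S" for D
    using meas[OF that] p0 by (simp add: measure_def info_kernel_def sum_nonneg)
  ultimately show ?thesis by blast
qed

lemma stochastic_info_kernel:
  "stochastic_kernel (info_space SX Oc r) SU (info_kernel SX Q Oc r \<rho>)"
  unfolding stochastic_kernel_def
proof (intro conjI ballI)
  fix D assume D: "D \<in> sets (info_space SX Oc r)"
  have "(\<lambda>s. s) \<in> info_space SX Oc r \<rightarrow>\<^sub>M info_ambient SX Oc r"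
    unfolding info_space_def by (rule measurable_restrict_space1) simp
  from measurable_compose[OF measurable_fst this]
  have id: "(\<lambda>z. (fst z, snd z)) \<in> info_space SX Oc r \<Otimes>\<^sub>M SU \<rightarrow>\<^sub>M info_ambient SX Oc r \<Otimes>\<^sub>M SU"
    by (rule measurable_Pair) simp
  show "(\<lambda>(s, u). info_kernel SX Q Oc r \<rho> D s u) \<in> borel_measurable (info_space SX Oc r \<Otimes>\<^sub>M SU)"
    using measurable_compose[OF id measurable_info_kernel[OF subsetD[OF sets_info_space_subset D]]]
    by (simp add: case_prod_beta')
next
  fix s u assume "s \<in> space (info_space SX Oc r)" "u \<in> space SU"
  then show "\<exists>\<kappa>\<in>space (prob_algebra (info_space SX Oc r)).
      \<forall>D\<in>sets (info_space SX Oc r). info_kernel SX Q Oc r \<rho> D s u = measure \<kappa> D"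
    using info_kernel_is_probability[of "snd s" u "fst s"]
    by (auto simp: space_info_space info_states_def beliefs_on_def)
qed

end

section \<open>Histories\<close>

lemma process_events_subset_Pow: "process_events M S Z T \<subseteq> Pow (space M)"
  unfolding process_events_def by (auto dest: sigma_sets_into_sp[rotated])

lemma process_events_subset_sets:
  assumes "space N = space M" "\<And>s. s \<in> T \<Longrightarrow> Z s \<in> N \<rightarrow>\<^sub>M S"
  shows "process_events M S Z T \<subseteq> sets N"
proof -
  have "(\<Union>t\<in>T. {Z t -` B \<inter> space M | B. B \<in> sets S}) \<subseteq> sets N"
    using measurable_sets[OF assms(2)] assms(1) by auto
  from sets.sigma_sets_subset[OF this] show ?thesis
    unfolding process_events_def assms(1) .
qed

lemma vimage_in_process_events:
  "s \<in> T \<Longrightarrow> B \<in> sets S \<Longrightarrow> Z s -` B \<inter> space M \<in> process_events M S Z T"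
  unfolding process_events_def by (intro sigma_sets.Basic) auto

lemma space_history [simp]: "space (history M S Z SU U t) = space M"
  and sets_history: "sets (history M S Z SU U t) =
    sigma_sets (space M) (process_events M S Z {..t} \<union> process_events M SU U {..<t})"
  unfolding history_def
  by (intro space_measure_of sets_measure_of Un_least process_events_subset_Pow)+

lemma space_history_action [simp]: "space (history_action M S Z SU U t) = space M"
  and sets_history_action: "sets (history_action M S Z SU U t) =
    sigma_sets (space M) (process_events M S Z {..t} \<union> process_events M SU U {..t})"
  unfolding history_action_def
  by (intro space_measure_of sets_measure_of Un_least process_events_subset_Pow)+

lemma sets_history_subset:
  assumes "space N = space M" "\<And>s. s \<le> t \<Longrightarrow> Z s \<in> N \<rightarrow>\<^sub>M S" "\<And>s. s < t \<Longrightarrow> U s \<in> N \<rightarrow>\<^sub>M SU"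
  shows "sets (history M S Z SU U t) \<subseteq> sets N"
  unfolding sets_history assms(1)[symmetric]
  by (intro sets.sigma_sets_subset Un_least process_events_subset_sets assms)
     (use assms(1) in auto)

lemma sets_history_action_subset:
  assumes "space N = space M" "\<And>s. s \<le> t \<Longrightarrow> Z s \<in> N \<rightarrow>\<^sub>M S" "\<And>s. s \<le> t \<Longrightarrow> U s \<in> N \<rightarrow>\<^sub>M SU"
  shows "sets (history_action M S Z SU U t) \<subseteq> sets N"
  unfolding sets_history_action assms(1)[symmetric]
  by (intro sets.sigma_sets_subset Un_least process_events_subset_sets assms)
     (use assms(1) in auto)

lemma sets_history_subset_history_action:
  "sets (history M S Z SU U t) \<subseteq> sets (history_action M S Z SU U t)"
proof -
  have "process_events M SU U {..<t} \<subseteq> process_events M SU U {..t}"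
    unfolding process_events_def by (intro sigma_sets_subseteq UN_mono) auto
  then show ?thesis
    unfolding sets_history sets_history_action by (intro sigma_sets_subseteq) auto
qed

lemma measurable_history_obs:
  assumes "s \<le> t" "\<And>\<omega>. \<omega> \<in> space M \<Longrightarrow> Z s \<omega> \<in> space S"
  shows "Z s \<in> history M S Z SU U t \<rightarrow>\<^sub>M S"
proof (rule measurableI)
  fix B assume "B \<in> sets S"
  from vimage_in_process_events[of s "{..t}", OF _ this, of Z M] assms(1)
  show "Z s -` B \<inter> space (history M S Z SU U t) \<in> sets (history M S Z SU U t)"
    unfolding sets_history by (auto intro: sigma_sets.Basic)
qed (use assms in auto)

lemma measurable_history_action:
  assumes "s < t" "\<And>\<omega>. \<omega> \<in> space M \<Longrightarrow> U s \<omega> \<in> space SU"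
  shows "U s \<in> history M S Z SU U t \<rightarrow>\<^sub>M SU"
proof (rule measurableI)
  fix B assume "B \<in> sets SU"
  from vimage_in_process_events[of s "{..<t}", OF _ this, of U M] assms(1)
  show "U s -` B \<inter> space (history M S Z SU U t) \<in> sets (history M S Z SU U t)"
    unfolding sets_history by (auto intro: sigma_sets.Basic)
qed (use assms in auto)

text \<open>
  Random variables of a smaller history are random variables of a larger one.
\<close>

lemma measurable_mono_sets:
  assumes "f \<in> F \<rightarrow>\<^sub>M N" "sets F \<subseteq> sets G" "space F = space G"
  shows "f \<in> G \<rightarrow>\<^sub>M N"
  using assms by (auto simp: measurable_def)

text \<open>
  Used with \<open>F\<close> a history and \<open>E\<close> the event of a given next label: proving that the generators of the next
  history belong to this \<open>\<sigma>\<close>-field shows that the next history has the same trace on \<open>E\<close>.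
\<close>

lemma sigma_algebra_trace_agreement:
  fixes F :: "'w measure"
  shows "sigma_algebra (space F) {S \<in> Pow (space F). \<exists>B\<in>sets F. S \<inter> E = B \<inter> E}"
  unfolding sigma_algebra_iff2
proof (intro conjI ballI allI impI)
  show "{S \<in> Pow (space F). \<exists>B\<in>sets F. S \<inter> E = B \<inter> E} \<subseteq> Pow (space F)" by auto
  show "{} \<in> {S \<in> Pow (space F). \<exists>B\<in>sets F. S \<inter> E = B \<inter> E}" by auto
  fix S assume "S \<in> {S \<in> Pow (space F). \<exists>B\<in>sets F. S \<inter> E = B \<inter> E}"
  then obtain B where "B \<in> sets F" "S \<inter> E = B \<inter> E" by auto
  then have "space F - B \<in> sets F" "(space F - S) \<inter> E = (space F - B) \<inter> E" by auto
  then show "space F - S \<in> {S \<in> Pow (space F). \<exists>B\<in>sets F. S \<inter> E = B \<inter> E}" by auto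
next
  fix A :: "nat \<Rightarrow> 'w set" assume A: "range A \<subseteq> {S \<in> Pow (space F). \<exists>B\<in>sets F. S \<inter> E = B \<inter> E}"
  then have "\<forall>i. \<exists>B. B \<in> sets F \<and> A i \<inter> E = B \<inter> E" by blast
  then obtain B where B: "\<And>i. B i \<in> sets F" "\<And>i. A i \<inter> E = B i \<inter> E" by metis
  have "(\<Union>i. B i) \<in> sets F" using B(1) by auto
  moreover have "(\<Union>i. A i) \<inter> E = (\<Union>i. B i) \<inter> E" using B(2) by blast
  ultimately show "(\<Union>i. A i) \<in> {S \<in> Pow (space F). \<exists>B\<in>sets F. S \<inter> E = B \<inter> E}"
    using A by blast
qed

section \<open>Random measures that agree almost surely\<close>

text \<open>
  The null set in the hypothesis depends on \<open>C\<close>. The sets \<open>D\<close> of measures for which the conclusion holds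
  form a \<open>\<sigma>\<close>-field, and by hypothesis all evaluations are measurable for it; hence it contains the
  \<open>\<sigma>\<close>-field that the evaluations generate.
\<close>

lemma AE_random_measures_agree:
  assumes \<kappa>: "\<And>\<omega>. \<omega> \<in> space M \<Longrightarrow> \<kappa> \<omega> \<in> space (prob_algebra S)"
    and \<kappa>': "\<And>\<omega>. \<omega> \<in> space M \<Longrightarrow> \<kappa>' \<omega> \<in> space (prob_algebra S)"
    and eq: "\<And>C. C \<in> sets S \<Longrightarrow> AE \<omega> in M. measure (\<kappa> \<omega>) C = measure (\<kappa>' \<omega>) C"
    and D: "D \<in> sets (prob_algebra S)"
  shows "AE \<omega> in M. \<kappa> \<omega> \<in> D \<longleftrightarrow> \<kappa>' \<omega> \<in> D"
proof -
  let ?P = "space (prob_algebra S)"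
  \<comment> \<open>\<open>N\<close> carries \<open>\<D>\<close> as its \<open>\<sigma>\<close>-field, which turns membership in \<open>\<D>\<close> into measurability.\<close>
  define \<D> where "\<D> = {D \<in> Pow ?P. AE \<omega> in M. \<kappa> \<omega> \<in> D \<longleftrightarrow> \<kappa>' \<omega> \<in> D}"
  define N where "N = measure_of ?P \<D> (\<lambda>_. 0)"
  have "sigma_algebra ?P \<D>"
    unfolding sigma_algebra_iff2
  proof (intro conjI ballI allI impI)
    show "\<D> \<subseteq> Pow ?P" "{} \<in> \<D>" by (auto simp: \<D>_def)
    show "?P - A \<in> \<D>" if "A \<in> \<D>" for A
    proof -
      from that have "AE \<omega> in M. \<kappa> \<omega> \<in> A \<longleftrightarrow> \<kappa>' \<omega> \<in> A" by (simp add: \<D>_def)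
      then have "AE \<omega> in M. \<kappa> \<omega> \<in> ?P - A \<longleftrightarrow> \<kappa>' \<omega> \<in> ?P - A"
        using AE_space by eventually_elim (use \<kappa> \<kappa>' in auto)
      then show ?thesis by (simp add: \<D>_def)
    qed
    fix A :: "nat \<Rightarrow> _" assume A: "range A \<subseteq> \<D>"
    then have "AE \<omega> in M. \<forall>i. \<kappa> \<omega> \<in> A i \<longleftrightarrow> \<kappa>' \<omega> \<in> A i"
      by (auto simp: AE_all_countable \<D>_def)
    then have "AE \<omega> in M. \<kappa> \<omega> \<in> (\<Union>i. A i) \<longleftrightarrow> \<kappa>' \<omega> \<in> (\<Union>i. A i)"
      by eventually_elim auto
    then show "(\<Union>i. A i) \<in> \<D>" using A by (auto simp: \<D>_def)
  qed
  then have sets_N: "sets N = \<D>" and space_N: "space N = ?P"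
    unfolding N_def by (simp_all add: sigma_algebra.sets_measure_of_eq sigma_algebra.space_measure_of_eq)
  have "(\<lambda>\<mu>. \<mu>) \<in> N \<rightarrow>\<^sub>M prob_algebra S"
  proof (rule measurable_prob_algebraI)
    show "prob_space \<mu>" if "\<mu> \<in> space N" for \<mu> using that by (simp add: space_N space_prob_algebra)
    show "(\<lambda>\<mu>. \<mu>) \<in> N \<rightarrow>\<^sub>M subprob_algebra S"
    proof (rule measurable_subprob_algebra)
      fix C assume C: "C \<in> sets S"
      have e: "emeasure (\<kappa> \<omega>) C = emeasure (\<kappa>' \<omega>) C" if "\<omega> \<in> space M"
        "measure (\<kappa> \<omega>) C = measure (\<kappa>' \<omega>) C" for \<omega>
        using that by (simp add: prob_algebra_emeasure_eq_measure[OF \<kappa>]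
            prob_algebra_emeasure_eq_measure[OF \<kappa>'])
      show "(\<lambda>\<mu>. emeasure \<mu> C) \<in> borel_measurable N"
      proof (rule measurableI)
        fix B :: "ennreal set"
        have "AE \<omega> in M. \<kappa> \<omega> \<in> (\<lambda>\<mu>. emeasure \<mu> C) -` B \<inter> ?P \<longleftrightarrow> \<kappa>' \<omega> \<in> (\<lambda>\<mu>. emeasure \<mu> C) -` B \<inter> ?P"
          using eq[OF C] AE_space by eventually_elim (use \<kappa> \<kappa>' e in auto)
        then show "(\<lambda>\<mu>. emeasure \<mu> C) -` B \<inter> space N \<in> sets N"
          by (simp add: sets_N space_N \<D>_def)
      qed simp
    qed (auto simp: space_N space_prob_algebra intro: prob_space_imp_subprob_space)
  qed
  from measurable_sets[OF this D] sets.sets_into_space[OF D]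
  have "D \<in> \<D>" by (simp add: sets_N space_N Int_absorb2)
  then show ?thesis by (simp add: \<D>_def)
qed

section \<open>The information process\<close>

context filter_model
begin

lemma label_of_state:
  assumes "x \<in> space SX" "\<And>j. j \<in> {1..r + 1} \<Longrightarrow> y = j \<longleftrightarrow> x \<in> Oc j"
  shows "y \<in> labels"
proof -
  have "x \<in> (\<Union>k\<in>labels. Oc k)" unfolding label_cells_cover by fact
  then obtain k where "k \<in> labels" "x \<in> Oc k" by auto
  then show ?thesis using assms(2)[of k] by (auto simp: obs_labels_def)
qed

lemma measurable_label:
  assumes x: "x \<in> F \<rightarrow>\<^sub>M SX"
    and y: "\<And>\<omega> j. \<omega> \<in> space F \<Longrightarrow> j \<in> {1..r + 1} \<Longrightarrow> y \<omega> = j \<longleftrightarrow> x \<omega> \<in> Oc j"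
  shows "y \<in> F \<rightarrow>\<^sub>M label_space Oc r"
proof -
  have "y -` {k} \<inter> space F \<in> sets F" if k: "k \<in> labels" for k
  proof -
    have "y -` {k} \<inter> space F = x -` Oc k \<inter> space F"
      using y k by (auto simp: obs_labels_def)
    also have "\<dots> \<in> sets F" by (rule measurable_sets[OF x label_cell_sets[OF k]])
    finally show ?thesis .
  qed
  then show ?thesis
    unfolding label_space_def
    by (subst measurable_count_space_eq2)
       (use label_of_state[OF measurable_space[OF x] y] in auto)
qed

end

text \<open>
  The dynamics enter only through \<open>transition\<close>: tested against events of the history, the next state is
  distributed according to \<open>Q\<close> at the current state and action. How the noise produces this is the subject
  of a later section.
\<close>

locale partially_observed_process = filter_model SX SU Q Oc r \<rho> + prob_space M
  for SX :: "'x measure" and SU :: "'u measure" and Q Oc r \<rho> and M :: "'w measure" +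
  fixes X :: "nat \<Rightarrow> 'w \<Rightarrow> 'x" and U :: "nat \<Rightarrow> 'w \<Rightarrow> 'u" and Y :: "nat \<Rightarrow> 'w \<Rightarrow> nat"
    and \<pi> :: "nat \<Rightarrow> 'w \<Rightarrow> 'x measure" and H :: "nat \<Rightarrow> 'w measure"
  assumes X_meas: "\<And>t. X t \<in> M \<rightarrow>\<^sub>M SX"
    and Y_iff: "\<And>t \<omega> j. \<omega> \<in> space M \<Longrightarrow> j \<in> {1..r + 1} \<Longrightarrow> Y t \<omega> = j \<longleftrightarrow> X t \<omega> \<in> Oc j"
    and H_eq: "H = history M (label_space Oc r) Y SU U"
    and U_H: "\<And>t. U t \<in> H t \<rightarrow>\<^sub>M SU"
    and pi_H: "\<And>t. \<pi> t \<in> H t \<rightarrow>\<^sub>M prob_algebra SX"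
    and pi_cond: "\<And>t C. C \<in> sets SX \<Longrightarrow>
           AE \<omega> in M. measure (\<pi> t \<omega>) C = cond_probability M (H t) (X t) C \<omega>"
    and transition: "\<And>t B C. B \<in> sets (H t) \<Longrightarrow> C \<in> sets SX \<Longrightarrow>
           emeasure M (B \<inter> {\<omega> \<in> space M. X (Suc t) \<omega> \<in> C}) =
             (\<integral>\<^sup>+ \<omega>. indicator B \<omega> * emeasure (Q (X t \<omega>) (U t \<omega>)) C \<partial>M)"
begin

lemma Y_label:
  assumes "\<omega> \<in> space M"
  shows "Y t \<omega> \<in> labels"
  by (rule label_of_state[OF measurable_space[OF X_meas assms] Y_iff[OF assms]])

lemma Y_eq_iff: "\<omega> \<in> space M \<Longrightarrow> k \<in> labels \<Longrightarrow> Y t \<omega> = k \<longleftrightarrow> X t \<omega> \<in> Oc k"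
  by (rule Y_iff) (auto simp: obs_labels_def)

lemma space_H [simp]: "space (H t) = space M"
  by (simp add: H_eq)

lemma Y_H: "s \<le> t \<Longrightarrow> Y s \<in> H t \<rightarrow>\<^sub>M label_space Oc r"
  unfolding H_eq by (rule measurable_history_obs) (use Y_label in \<open>auto simp: label_space_def\<close>)

lemma Y_H_count: "s \<le> t \<Longrightarrow> Y s \<in> H t \<rightarrow>\<^sub>M count_space labels"
  using Y_H by (simp add: label_space_def)

lemma U_space: "\<omega> \<in> space M \<Longrightarrow> U t \<omega> \<in> space SU"
  using measurable_space[OF U_H] by simp

lemma pi_space: "\<omega> \<in> space M \<Longrightarrow> \<pi> t \<omega> \<in> space PX"
  using measurable_space[OF pi_H] by simp

lemma Y_M: "Y t \<in> M \<rightarrow>\<^sub>M label_space Oc r"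
  by (rule measurable_label[OF X_meas Y_iff])

text \<open>
  Actions are measurable with respect to the history that earlier actions generate, so measurability on
  \<open>M\<close> is obtained by induction over time.
\<close>

lemma sets_H_subset: "sets (H t) \<subseteq> sets M"
proof (induction t rule: less_induct)
  case (less t)
  show ?case
    unfolding H_eq
  proof (rule sets_history_subset)
    show "U s \<in> M \<rightarrow>\<^sub>M SU" if "s < t" for s
      by (rule measurable_mono_sets[OF U_H less[OF that]]) simp
  qed (auto intro: Y_M)
qed

lemma subalgebra_H: "subalgebra M (H t)"
  unfolding subalgebra_def using sets_H_subset by simp

lemma sets_H_mono:
  assumes "s \<le> t"
  shows "sets (H s) \<subseteq> sets (H t)"
  unfolding H_eq[unfolded fun_eq_iff, rule_format, of s]
proof (rule sets_history_subset)
  show "Y i \<in> H t \<rightarrow>\<^sub>M label_space Oc r" if "i \<le> s" for i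
    using that assms by (intro Y_H) simp
  show "U i \<in> H t \<rightarrow>\<^sub>M SU" if "i < s" for i
    unfolding H_eq using that assms U_space by (intro measurable_history_action) auto
qed simp

lemma U_H_le:
  assumes "s \<le> t"
  shows "U s \<in> H t \<rightarrow>\<^sub>M SU"
  by (rule measurable_mono_sets[OF U_H sets_H_mono[OF assms]]) simp

lemma pi_H_le:
  assumes "s \<le> t"
  shows "\<pi> s \<in> H t \<rightarrow>\<^sub>M PX"
  by (rule measurable_mono_sets[OF pi_H sets_H_mono[OF assms]]) simp

lemma cond_law_pi: "cond_law M (H t) SX (X t) (\<pi> t)"
  by (rule cond_probability_imp_cond_law[OF prob_space_axioms subalgebra_H pi_H X_meas pi_cond])

lemma H_pair: "s \<le> t \<Longrightarrow> (\<lambda>\<omega>. (\<pi> s \<omega>, U s \<omega>)) \<in> H t \<rightarrow>\<^sub>M PX \<Otimes>\<^sub>M SU"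
  using pi_H_le U_H_le by (rule measurable_Pair)

text \<open>
  Disintegrate the transition identity over \<open>X\<^sub>t\<close>, whose conditional law is the belief; the action is
  fixed by the history. The inner integral is the prediction.
\<close>

lemma cond_law_predict:
  "cond_law M (H t) SX (X (Suc t)) (\<lambda>\<omega>. pred (\<pi> t \<omega>) (U t \<omega>))"
  unfolding cond_law_def
proof (intro conjI ballI X_meas)
  show "(\<lambda>\<omega>. pred (\<pi> t \<omega>) (U t \<omega>)) \<in> H t \<rightarrow>\<^sub>M PX"
    using measurable_compose[OF H_pair[OF order_refl] measurable_predict] by simp
  fix B C assume B: "B \<in> sets (H t)" and C: "C \<in> sets SX"
  note U_H[measurable] B[measurable]
  have "(\<lambda>z. (snd z, U t (fst z))) \<in> H t \<Otimes>\<^sub>M SX \<rightarrow>\<^sub>M SX \<Otimes>\<^sub>M SU" by measurable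
  from measurable_compose[OF measurable_compose[OF this kernel] measurable_emeasure_prob_algebra[OF C]]
  have [measurable]: "(\<lambda>z. emeasure (Q (snd z) (U t (fst z))) C) \<in> borel_measurable (H t \<Otimes>\<^sub>M SX)"
    by simp
  have m: "(\<lambda>(\<omega>, x). indicator B \<omega> * emeasure (Q x (U t \<omega>)) C) \<in> borel_measurable (H t \<Otimes>\<^sub>M SX)"
    unfolding case_prod_beta' by measurable
  have "emeasure M (B \<inter> {\<omega> \<in> space M. X (Suc t) \<omega> \<in> C}) =
      (\<integral>\<^sup>+ \<omega>. indicator B \<omega> * emeasure (Q (X t \<omega>) (U t \<omega>)) C \<partial>M)"
    by (rule transition[OF B C])
  also have "\<dots> = (\<integral>\<^sup>+ \<omega>. (\<integral>\<^sup>+ x. indicator B \<omega> * emeasure (Q x (U t \<omega>)) C \<partial>\<pi> t \<omega>) \<partial>M)"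
    by (rule nn_integral_cond_law[OF prob_space_axioms subalgebra_H cond_law_pi m])
  also have "\<dots> = (\<integral>\<^sup>+ \<omega>. indicator B \<omega> * emeasure (pred (\<pi> t \<omega>) (U t \<omega>)) C \<partial>M)"
  proof (rule nn_integral_cong)
    fix \<omega> assume \<omega>: "\<omega> \<in> space M"
    show "(\<integral>\<^sup>+ x. indicator B \<omega> * emeasure (Q x (U t \<omega>)) C \<partial>\<pi> t \<omega>) =
        indicator B \<omega> * emeasure (pred (\<pi> t \<omega>) (U t \<omega>)) C"
      by (cases "\<omega> \<in> B") (simp_all add: emeasure_predict[OF pi_space[OF \<omega>] U_space[OF \<omega>] C])
  qed
  finally show "emeasure M (B \<inter> {\<omega> \<in> space M. X (Suc t) \<omega> \<in> C}) =
      (\<integral>\<^sup>+ \<omega>. indicator B \<omega> * emeasure (pred (\<pi> t \<omega>) (U t \<omega>)) C \<partial>M)" .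
qed

text \<open>
  The probability \<open>p\<^sub>k(\<pi>\<^sub>t, U\<^sub>t)\<close> is the conditional probability of the next label, tested here against
  functions of the history instead of events.
\<close>

lemma nn_integral_next_label:
  assumes g[measurable]: "g \<in> borel_measurable (H t)" and k: "k \<in> labels"
  shows "(\<integral>\<^sup>+ \<omega>. g \<omega> * indicator {\<omega>. Y (Suc t) \<omega> = k} \<omega> \<partial>M) =
    (\<integral>\<^sup>+ \<omega>. g \<omega> * ennreal (p k (\<pi> t \<omega>) (U t \<omega>)) \<partial>M)"
proof -
  note label_cell_sets[OF k, measurable]
  have m: "(\<lambda>(\<omega>, x). g \<omega> * indicator (Oc k) x) \<in> borel_measurable (H t \<Otimes>\<^sub>M SX)"
    unfolding case_prod_beta' by measurable
  have "(\<integral>\<^sup>+ \<omega>. g \<omega> * indicator {\<omega>. Y (Suc t) \<omega> = k} \<omega> \<partial>M) =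
      (\<integral>\<^sup>+ \<omega>. g \<omega> * indicator (Oc k) (X (Suc t) \<omega>) \<partial>M)"
    by (rule nn_integral_cong) (simp add: indicator_def Y_eq_iff[OF _ k])
  also have "\<dots> = (\<integral>\<^sup>+ \<omega>. (\<integral>\<^sup>+ x. g \<omega> * indicator (Oc k) x \<partial>pred (\<pi> t \<omega>) (U t \<omega>)) \<partial>M)"
    by (rule nn_integral_cond_law[OF prob_space_axioms subalgebra_H cond_law_predict m])
  also have "\<dots> = (\<integral>\<^sup>+ \<omega>. g \<omega> * ennreal (p k (\<pi> t \<omega>) (U t \<omega>)) \<partial>M)"
  proof (rule nn_integral_cong)
    fix \<omega> assume \<omega>: "\<omega> \<in> space M"
    have "sets (pred (\<pi> t \<omega>) (U t \<omega>)) = sets SX"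
      using predict_in_space[OF pi_space[OF \<omega>] U_space[OF \<omega>]] by (simp add: space_prob_algebra)
    then have "Oc k \<in> sets (pred (\<pi> t \<omega>) (U t \<omega>))" using label_cell_sets[OF k] by simp
    then show "(\<integral>\<^sup>+ x. g \<omega> * indicator (Oc k) x \<partial>pred (\<pi> t \<omega>) (U t \<omega>)) =
        g \<omega> * ennreal (p k (\<pi> t \<omega>) (U t \<omega>))"
      by (simp add: nn_integral_cmult_indicator emeasure_pred_cell[OF pi_space[OF \<omega>] U_space[OF \<omega>]])
  qed
  finally show ?thesis .
qed

lemma sum_label_indicator:
  assumes "\<omega> \<in> space M"
  shows "(\<Sum>k\<in>labels. f k * indicator {\<omega>. Y t \<omega> = k} \<omega>) = (f (Y t \<omega>) :: ennreal)"
proof -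
  have "(\<Sum>k\<in>labels. f k * indicator {\<omega>. Y t \<omega> = k} \<omega>) = (\<Sum>k\<in>labels. if Y t \<omega> = k then f k else 0)"
    by (rule sum.cong) (auto simp: indicator_def)
  then show ?thesis using Y_label[OF assms] by (simp add: sum.delta')
qed

lemma label_event_M: "{\<omega> \<in> space M. Y t \<omega> = k} \<in> sets M"
proof -
  have "{\<omega> \<in> space M. Y t \<omega> = k} = Y t -` ({k} \<inter> labels) \<inter> space M" using Y_label by auto
  also have "\<dots> \<in> sets M" by (rule measurable_sets[OF Y_M]) (simp add: label_space_def)
  finally show ?thesis .
qed

text \<open>
  Passing from one history to the next adds only the next label, since the action \<open>U\<^sub>t\<close> is already known
  at time \<open>t\<close>; and once the label is fixed to \<open>k\<close>, nothing is added.
\<close>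

lemma H_Suc_trace:
  assumes B: "B \<in> sets (H (Suc t))"
  obtains B' where "B' \<in> sets (H t)"
    "B \<inter> {\<omega>. Y (Suc t) \<omega> = k} = B' \<inter> {\<omega>. Y (Suc t) \<omega> = k}"
proof -
  let ?E = "{\<omega>. Y (Suc t) \<omega> = k}"
  define \<T> where "\<T> = {S \<in> Pow (space (H t)). \<exists>B\<in>sets (H t). S \<inter> ?E = B \<inter> ?E}"
  define N where "N = measure_of (space (H t)) \<T> (\<lambda>_. 0)"
  have "sigma_algebra (space (H t)) \<T>" unfolding \<T>_def by (rule sigma_algebra_trace_agreement)
  then have sets_N: "sets N = \<T>" and space_N: "space N = space M"
    unfolding N_def by (simp_all add: sigma_algebra.sets_measure_of_eq sigma_algebra.space_measure_of_eq)
  have HN: "sets (H t) \<subseteq> sets N"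
    unfolding sets_N \<T>_def using sets.sets_into_space by blast
  have "sets (H (Suc t)) \<subseteq> sets N"
    unfolding H_eq[unfolded fun_eq_iff, rule_format, of "Suc t"]
  proof (rule sets_history_subset[OF space_N])
    show "U s \<in> N \<rightarrow>\<^sub>M SU" if "s < Suc t" for s
      by (rule measurable_mono_sets[OF U_H_le[of s t] HN]) (use that space_N in auto)
    show "Y s \<in> N \<rightarrow>\<^sub>M label_space Oc r" if "s \<le> Suc t" for s
    proof (cases "s \<le> t")
      case True
      then show ?thesis
        by (intro measurable_mono_sets[OF Y_H[of s t] HN]) (use space_N in auto)
    next
      case False
      with that have s: "s = Suc t" by simp
      show ?thesis
      proof (rule measurableI)
        show "Y s \<omega> \<in> space (label_space Oc r)" if "\<omega> \<in> space N" for \<omega>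
          using Y_label that by (simp add: space_N label_space_def)
        fix L :: "nat set"
        \<comment> \<open>On \<open>?E\<close> the new label is constant, so its events are trivial there.\<close>
        have "(Y s -` L \<inter> space M) \<inter> ?E = (if k \<in> L then space (H t) else {}) \<inter> ?E"
          by (auto simp: s)
        then have "Y s -` L \<inter> space M \<in> \<T>"
          unfolding \<T>_def using sets.top[of "H t"] by (auto intro!: bexI[of _ "if k \<in> L then space (H t) else {}"])
        then show "Y s -` L \<inter> space N \<in> sets N" by (simp add: sets_N space_N)
      qed
    qed
  qed
  with B have "B \<in> \<T>" by (auto simp: sets_N)
  then show thesis using that unfolding \<T>_def by auto
qed

text \<open>
  Split an event of the new history according to the next label. On the part with label \<open>k\<close> it may be
  replaced by an event \<open>B'\<close> of the old history, and there Bayes' rule turns the predicted mass of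
  \<open>C \<inter> O\<^sub>k\<close> into \<open>p\<^sub>k \<Phi>\<^sub>k(C)\<close>; finally \<open>p\<^sub>k\<close> is exchanged for the indicator of the label.
\<close>

lemma cond_law_filter_update:
  "cond_law M (H (Suc t)) SX (X (Suc t)) (\<lambda>\<omega>. \<Phi> (Y (Suc t) \<omega>) (\<pi> t \<omega>) (U t \<omega>))"
  unfolding cond_law_def
proof (intro conjI ballI X_meas)
  have \<Phi>_meas: "(\<lambda>\<omega>. \<Phi> k (\<pi> t \<omega>) (U t \<omega>)) \<in> H s \<rightarrow>\<^sub>M PX" if "k \<in> labels" "t \<le> s" for k s
    using measurable_compose[OF H_pair[OF that(2)] measurable_filter_update[OF that(1)]] by simp
  show "(\<lambda>\<omega>. \<Phi> (Y (Suc t) \<omega>) (\<pi> t \<omega>) (U t \<omega>)) \<in> H (Suc t) \<rightarrow>\<^sub>M PX"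
    by (rule measurable_compose_countable'[OF \<Phi>_meas Y_H_count])
       (auto intro: countable_finite)
  fix B C assume B: "B \<in> sets (H (Suc t))" and C: "C \<in> sets SX"
  let ?\<kappa> = "\<lambda>k \<omega>. emeasure (\<Phi> k (\<pi> t \<omega>) (U t \<omega>)) C"
  let ?XC = "{\<omega> \<in> space M. X (Suc t) \<omega> \<in> C}"
  have BM[measurable]: "B \<in> sets M" using B sets_H_subset by auto
  note label_event_M[measurable] X_meas[measurable] C[measurable]
  have Phi_H: "?\<kappa> k \<in> borel_measurable (H t)" if "k \<in> labels" for k
    by (rule measurable_compose[OF \<Phi>_meas[OF that order_refl] measurable_emeasure_prob_algebra[OF C]])
  have part: "(\<integral>\<^sup>+ \<omega>. indicator (B \<inter> ?XC) \<omega> * indicator {\<omega>. Y (Suc t) \<omega> = k} \<omega> \<partial>M) =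
      (\<integral>\<^sup>+ \<omega>. indicator B \<omega> * ?\<kappa> k \<omega> * indicator {\<omega>. Y (Suc t) \<omega> = k} \<omega> \<partial>M)"
    if k: "k \<in> labels" for k
  proof -
    obtain B' where B': "B' \<in> sets (H t)"
      and eq: "B \<inter> {\<omega>. Y (Suc t) \<omega> = k} = B' \<inter> {\<omega>. Y (Suc t) \<omega> = k}"
      using H_Suc_trace[OF B] .
    have sw: "\<omega> \<in> B \<longleftrightarrow> \<omega> \<in> B'" if "Y (Suc t) \<omega> = k" for \<omega> using eq that by blast
    have CO: "C \<inter> Oc k \<in> sets SX" using C label_cell_sets[OF k] by auto
    have B'M: "B' \<in> sets M" using B' sets_H_subset by auto
    note [measurable] = Phi_H[OF k] B'
    have "(\<integral>\<^sup>+ \<omega>. indicator (B \<inter> ?XC) \<omega> * indicator {\<omega>. Y (Suc t) \<omega> = k} \<omega> \<partial>M) =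
        (\<integral>\<^sup>+ \<omega>. indicator (B' \<inter> {\<omega> \<in> space M. X (Suc t) \<omega> \<in> C \<inter> Oc k}) \<omega> \<partial>M)"
      by (rule nn_integral_cong) (use sw in \<open>auto simp: indicator_def Y_eq_iff[OF _ k]\<close>)
    also have "\<dots> = emeasure M (B' \<inter> {\<omega> \<in> space M. X (Suc t) \<omega> \<in> C \<inter> Oc k})"
      by (rule nn_integral_indicator) (use B'M CO in measurable)
    also have "\<dots> = (\<integral>\<^sup>+ \<omega>. indicator B' \<omega> * emeasure (pred (\<pi> t \<omega>) (U t \<omega>)) (C \<inter> Oc k) \<partial>M)"
      by (rule cond_lawD(3)[OF cond_law_predict B' CO])
    also have "\<dots> = (\<integral>\<^sup>+ \<omega>. indicator B' \<omega> * ?\<kappa> k \<omega> * ennreal (p k (\<pi> t \<omega>) (U t \<omega>)) \<partial>M)"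
      by (rule nn_integral_cong)
         (simp add: obs_prob_mult_filter_update[OF pi_space U_space k C, symmetric] mult_ac)
    also have "\<dots> = (\<integral>\<^sup>+ \<omega>. indicator B' \<omega> * ?\<kappa> k \<omega> * indicator {\<omega>. Y (Suc t) \<omega> = k} \<omega> \<partial>M)"
      by (rule nn_integral_next_label[symmetric, OF _ k]) measurable
    also have "\<dots> = (\<integral>\<^sup>+ \<omega>. indicator B \<omega> * ?\<kappa> k \<omega> * indicator {\<omega>. Y (Suc t) \<omega> = k} \<omega> \<partial>M)"
      by (rule nn_integral_cong) (use sw in \<open>auto simp: indicator_def\<close>)
    finally show ?thesis .
  qed
  have meas_label: "indicator {\<omega>. Y (Suc t) \<omega> = k} \<in> borel_measurable M" for k
    using label_event_M[of "Suc t" k] by (simp add: borel_measurable_indicator_iff Int_def conj_commute)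
  have "emeasure M (B \<inter> ?XC) = (\<integral>\<^sup>+ \<omega>. indicator (B \<inter> ?XC) \<omega> \<partial>M)"
    by simp
  also have "\<dots> = (\<integral>\<^sup>+ \<omega>. (\<Sum>k\<in>labels. indicator (B \<inter> ?XC) \<omega> * indicator {\<omega>. Y (Suc t) \<omega> = k} \<omega>) \<partial>M)"
    by (rule nn_integral_cong) (rule sum_label_indicator[symmetric])
  also have "\<dots> = (\<Sum>k\<in>labels. \<integral>\<^sup>+ \<omega>. indicator (B \<inter> ?XC) \<omega> * indicator {\<omega>. Y (Suc t) \<omega> = k} \<omega> \<partial>M)"
    using meas_label by (intro nn_integral_sum) auto
  also have "\<dots> = (\<Sum>k\<in>labels. \<integral>\<^sup>+ \<omega>. indicator B \<omega> * ?\<kappa> k \<omega> * indicator {\<omega>. Y (Suc t) \<omega> = k} \<omega> \<partial>M)"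
    by (rule sum.cong[OF refl part])
  also have "\<dots> = (\<integral>\<^sup>+ \<omega>. (\<Sum>k\<in>labels. indicator B \<omega> * ?\<kappa> k \<omega> * indicator {\<omega>. Y (Suc t) \<omega> = k} \<omega>) \<partial>M)"
    by (intro nn_integral_sum[symmetric] borel_measurable_times_ennreal meas_label
        measurable_from_subalg[OF subalgebra_H Phi_H] borel_measurable_indicator BM)
  also have "\<dots> = (\<integral>\<^sup>+ \<omega>. indicator B \<omega> * ?\<kappa> (Y (Suc t) \<omega>) \<omega> \<partial>M)"
    by (rule nn_integral_cong) (simp only: sum_label_indicator)
  finally show "emeasure M (B \<inter> ?XC) =
      (\<integral>\<^sup>+ \<omega>. indicator B \<omega> * emeasure (\<Phi> (Y (Suc t) \<omega>) (\<pi> t \<omega>) (U t \<omega>)) C \<partial>M)" .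
qed

text \<open>
  Both random measures are versions of the conditional law of \<open>X\<^sub>t\<^sub>+\<^sub>1\<close> given the new history.
\<close>

lemma pi_eq_filter_update:
  assumes "D \<in> sets PX"
  shows "AE \<omega> in M. \<pi> (Suc t) \<omega> \<in> D \<longleftrightarrow> \<Phi> (Y (Suc t) \<omega>) (\<pi> t \<omega>) (U t \<omega>) \<in> D"
proof (rule AE_random_measures_agree[OF _ _ _ assms])
  show "\<pi> (Suc t) \<omega> \<in> space PX" if "\<omega> \<in> space M" for \<omega>
    by (rule pi_space[OF that])
  show "\<Phi> (Y (Suc t) \<omega>) (\<pi> t \<omega>) (U t \<omega>) \<in> space PX" if "\<omega> \<in> space M" for \<omega>
    by (rule filter_update_in_space[OF pi_space U_space Y_label]) (rule that)+
  show "AE \<omega> in M. measure (\<pi> (Suc t) \<omega>) C = measure (\<Phi> (Y (Suc t) \<omega>) (\<pi> t \<omega>) (U t \<omega>)) C"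
    if "C \<in> sets SX" for C
    using pi_cond[OF that, of "Suc t"]
      cond_law_imp_cond_probability[OF prob_space_axioms subalgebra_H cond_law_filter_update that, of t]
    by eventually_elim simp
qed

abbreviation "info t \<omega> \<equiv> (Y t \<omega>, \<pi> t \<omega>)"

lemma info_H: "s \<le> t \<Longrightarrow> info s \<in> H t \<rightarrow>\<^sub>M info_ambient SX Oc r"
  unfolding info_ambient_def by (intro measurable_Pair Y_H pi_H_le)

text \<open>
  Whether \<open>X\<^sub>t\<close> lies in \<open>O\<^sub>k\<close> is known from \<open>Y\<^sub>t\<close>, so the conditional probability of this event is
  its indicator; hence the belief charges exactly the observed cell.
\<close>

lemma info_in_states: "AE \<omega> in M. info t \<omega> \<in> info_states SX Oc r"
proof -
  have "AE \<omega> in M. measure (\<pi> t \<omega>) (Oc k) = indicator {\<omega>. Y t \<omega> = k} \<omega>" if k: "k \<in> labels" for k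
  proof -
    interpret S: sigma_finite_subalgebra M "H t"
      by (rule subalgebra_prob_space_sigma_finite[OF prob_space_axioms subalgebra_H])
    let ?E = "{\<omega> \<in> space M. X t \<omega> \<in> Oc k}"
    have E: "?E = Y t -` {k} \<inter> space (H t)" using Y_eq_iff[OF _ k] by auto
    have EH: "?E \<in> sets (H t)"
      unfolding E by (rule measurable_sets[OF Y_H_count[OF order_refl]]) (use k in simp)
    then have EM: "?E \<in> sets M" using sets_H_subset by auto
    have "AE \<omega> in M. real_cond_exp M (H t) (indicator ?E) \<omega> = indicator ?E \<omega>"
      using EH EM by (intro S.real_cond_exp_F_meas) (auto simp: less_top[symmetric])
    then show ?thesis
      using pi_cond[OF label_cell_sets[OF k], of t] AE_space
      by eventually_elim (simp add: cond_probability_def indicator_def Y_eq_iff[OF _ k])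
  qed
  then have "AE \<omega> in M. \<forall>k\<in>labels. measure (\<pi> t \<omega>) (Oc k) = indicator {\<omega>. Y t \<omega> = k} \<omega>"
    by (intro AE_finite_allI) auto
  then show ?thesis
    using AE_space
  proof eventually_elim
    case (elim \<omega>)
    then have "\<pi> t \<omega> \<in> beliefs_on SX Oc (Y t \<omega>)"
      using Y_label[of \<omega> t] pi_space[of \<omega> t] by (simp add: beliefs_on_def)
    with Y_label[OF elim(2)] show ?case unfolding info_states_def by blast
  qed
qed

text \<open>
  The \<open>\<sigma>\<close>-field \<open>F\<close> is a parameter because conditioning is required both on \<open>H t\<close> and on the history of
  information states and actions, which is generated by other variables but has the same events.
\<close>

lemma info_transition:
  assumes F: "sets F = sets (H t)" and D: "D \<in> sets (info_ambient SX Oc r)"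
  shows "AE \<omega> in M. cond_probability M F (info (Suc t)) D \<omega> =
    info_kernel SX Q Oc r \<rho> D (info t \<omega>) (U t \<omega>)"
  unfolding cond_probability_def
proof (rule real_cond_exp_indicator_eqI[OF prob_space_axioms])
  let ?K = "\<lambda>\<omega>. info_kernel SX Q Oc r \<rho> D (info t \<omega>) (U t \<omega>)"
  let ?E = "{\<omega> \<in> space M. info (Suc t) \<omega> \<in> D}"
  have spF: "space F = space M" using sets_eq_imp_space_eq[OF F] by simp
  show "subalgebra M F" using subalgebra_H[of t] by (simp add: subalgebra_def F spF)
  have I_M: "info (Suc t) \<in> M \<rightarrow>\<^sub>M info_ambient SX Oc r"
    by (rule measurable_from_subalg[OF subalgebra_H info_H[OF order_refl]])
  show EM: "?E \<in> sets M"
    using measurable_sets[OF I_M D] by (simp add: vimage_def Int_def conj_commute)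
  have "(\<lambda>\<omega>. (info t \<omega>, U t \<omega>)) \<in> H t \<rightarrow>\<^sub>M info_ambient SX Oc r \<Otimes>\<^sub>M SU"
    using info_H[OF order_refl] U_H by (rule measurable_Pair)
  from measurable_compose[OF this measurable_info_kernel[OF D]]
  have "?K \<in> borel_measurable (H t)" by simp
  then show "?K \<in> borel_measurable F" by (simp add: measurable_cong_sets[OF F refl])
  show "0 \<le> ?K \<omega> \<and> ?K \<omega> \<le> 1" if \<omega>: "\<omega> \<in> space M" for \<omega>
  proof
    show "0 \<le> ?K \<omega>" by (simp add: info_kernel_def obs_prob_def sum_nonneg)
    have "?K \<omega> \<le> (\<Sum>k\<in>labels. p k (\<pi> t \<omega>) (U t \<omega>))"
      unfolding info_kernel_def by (intro sum_mono) (simp add: indicator_def obs_prob_def)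
    then show "?K \<omega> \<le> 1" by (simp add: sum_obs_prob[OF pi_space[OF \<omega>] U_space[OF \<omega>]])
  qed
  fix B assume "B \<in> sets F"
  then have B[measurable]: "B \<in> sets (H t)" by (simp add: F)
  have BM: "B \<in> sets M" by (rule subsetD[OF sets_H_subset B])
  let ?d = "\<lambda>k \<omega>. indicator D (k, \<Phi> k (\<pi> t \<omega>) (U t \<omega>)) :: ennreal"
  have d[measurable]: "?d k \<in> borel_measurable (H t)" if "k \<in> labels" for k
    using measurable_compose[OF measurable_compose[OF H_pair[OF order_refl]
          measurable_labelled_filter_update[OF that]] borel_measurable_indicator[OF D]] by simp
  have ae: "AE \<omega> in M. info (Suc t) \<omega> \<in> D \<longleftrightarrow>
      (Y (Suc t) \<omega>, \<Phi> (Y (Suc t) \<omega>) (\<pi> t \<omega>) (U t \<omega>)) \<in> D"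
  proof -
    have "AE \<omega> in M. \<forall>k\<in>labels. \<pi> (Suc t) \<omega> \<in> Pair k -` D \<longleftrightarrow>
        \<Phi> (Y (Suc t) \<omega>) (\<pi> t \<omega>) (U t \<omega>) \<in> Pair k -` D"
      using D unfolding info_ambient_def
      by (intro AE_finite_allI finite_labels pi_eq_filter_update sets_Pair1)
    then show ?thesis
      using AE_space by eventually_elim (use Y_label in auto)
  qed
  have meas_label: "indicator {\<omega>. Y (Suc t) \<omega> = k} \<in> borel_measurable M" for k
    using label_event_M[of "Suc t" k] by (simp add: borel_measurable_indicator_iff Int_def conj_commute)
  have "emeasure M (B \<inter> ?E) = (\<integral>\<^sup>+ \<omega>. indicator (B \<inter> ?E) \<omega> \<partial>M)"
    using BM EM by simp
  also have "\<dots> = (\<integral>\<^sup>+ \<omega>. indicator B \<omega> * ?d (Y (Suc t) \<omega>) \<omega> \<partial>M)"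
    by (rule nn_integral_cong_AE) (use ae AE_space in eventually_elim, auto simp: indicator_def)
  also have "\<dots> = (\<integral>\<^sup>+ \<omega>. (\<Sum>k\<in>labels. indicator B \<omega> * ?d k \<omega> * indicator {\<omega>. Y (Suc t) \<omega> = k} \<omega>) \<partial>M)"
    by (rule nn_integral_cong) (simp only: sum_label_indicator)
  also have "\<dots> = (\<Sum>k\<in>labels. \<integral>\<^sup>+ \<omega>. indicator B \<omega> * ?d k \<omega> * indicator {\<omega>. Y (Suc t) \<omega> = k} \<omega> \<partial>M)"
    by (intro nn_integral_sum borel_measurable_times_ennreal meas_label
        measurable_from_subalg[OF subalgebra_H d] borel_measurable_indicator BM)
  also have "\<dots> = (\<Sum>k\<in>labels. \<integral>\<^sup>+ \<omega>. indicator B \<omega> * ?d k \<omega> * ennreal (p k (\<pi> t \<omega>) (U t \<omega>)) \<partial>M)"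
    by (intro sum.cong refl nn_integral_next_label borel_measurable_times_ennreal borel_measurable_indicator B d)
  also have "\<dots> = (\<integral>\<^sup>+ \<omega>. (\<Sum>k\<in>labels. indicator B \<omega> * ?d k \<omega> * ennreal (p k (\<pi> t \<omega>) (U t \<omega>))) \<partial>M)"
  proof (rule nn_integral_sum[symmetric])
    fix k assume k: "k \<in> labels"
    have "(\<lambda>\<omega>. p k (\<pi> t \<omega>) (U t \<omega>)) \<in> borel_measurable (H t)"
      using measurable_compose[OF H_pair[OF order_refl] measurable_obs_prob[OF k]] by simp
    with d[OF k] have "(\<lambda>\<omega>. indicator B \<omega> * ?d k \<omega> * ennreal (p k (\<pi> t \<omega>) (U t \<omega>)))
        \<in> borel_measurable (H t)" by measurable
    then show "(\<lambda>\<omega>. indicator B \<omega> * ?d k \<omega> * ennreal (p k (\<pi> t \<omega>) (U t \<omega>)))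
        \<in> borel_measurable M" by (rule measurable_from_subalg[OF subalgebra_H])
  qed
  also have "\<dots> = (\<integral>\<^sup>+ \<omega>. indicator B \<omega> * ennreal (?K \<omega>) \<partial>M)"
  proof (rule nn_integral_cong)
    fix \<omega>
    have "ennreal (?K \<omega>) = (\<Sum>k\<in>labels. ennreal (p k (\<pi> t \<omega>) (U t \<omega>) * indicator D (k, \<Phi> k (\<pi> t \<omega>) (U t \<omega>))))"
      unfolding info_kernel_def snd_conv by (rule sum_ennreal[symmetric]) (simp add: obs_prob_def)
    also have "\<dots> = (\<Sum>k\<in>labels. ?d k \<omega> * ennreal (p k (\<pi> t \<omega>) (U t \<omega>)))"
      by (rule sum.cong) (simp_all add: indicator_def)
    finally show "(\<Sum>k\<in>labels. indicator B \<omega> * ?d k \<omega> * ennreal (p k (\<pi> t \<omega>) (U t \<omega>))) =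
        indicator B \<omega> * ennreal (?K \<omega>)"
      by (simp only: sum_distrib_left mult.assoc)
  qed
  finally show "emeasure M (B \<inter> ?E) = (\<integral>\<^sup>+ \<omega>. indicator B \<omega> * ennreal (?K \<omega>) \<partial>M)" .
qed

lemma sets_H_info_history:
  "sets (H t) \<subseteq> sets (history M (info_ambient SX Oc r) info SU U t)"
proof -
  let ?F = "history M (info_ambient SX Oc r) info SU U t"
  have "Y s \<in> ?F \<rightarrow>\<^sub>M label_space Oc r" if "s \<le> t" for s
  proof -
    have "info s \<in> ?F \<rightarrow>\<^sub>M info_ambient SX Oc r"
      using that measurable_space[OF info_H[OF order_refl]] by (intro measurable_history_obs) auto
    moreover have "fst \<in> info_ambient SX Oc r \<rightarrow>\<^sub>M label_space Oc r"
      unfolding info_ambient_def by (rule measurable_fst)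
    ultimately show ?thesis by (auto dest: measurable_compose)
  qed
  moreover have "U s \<in> ?F \<rightarrow>\<^sub>M SU" if "s < t" for s
    using that U_space by (intro measurable_history_action) auto
  ultimately show ?thesis
    unfolding H_eq[unfolded fun_eq_iff, rule_format, of t] by (intro sets_history_subset) auto
qed

text \<open>
  The label can be read off the information state, and conversely the belief and the actions are
  functions of the label history.
\<close>

lemma sets_info_history_action:
  "sets (history_action M (info_ambient SX Oc r) info SU U t) = sets (H t)"
proof (rule antisym)
  show "sets (history_action M (info_ambient SX Oc r) info SU U t) \<subseteq> sets (H t)"
    by (intro sets_history_action_subset info_H U_H_le) auto
  show "sets (H t) \<subseteq> sets (history_action M (info_ambient SX Oc r) info SU U t)"
    using sets_H_info_history sets_history_subset_history_action by (rule order_trans)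
qed

lemma info_process_controlled_markov:
  "completely_observable_controlled_markov M H (info_ambient SX Oc r) (info_states SX Oc r)
     SU (info_kernel SX Q Oc r \<rho>) info U"
  unfolding completely_observable_controlled_markov_def markov_transitions_def
proof (intro conjI allI ballI)
  show "stochastic_kernel (restrict_space (info_ambient SX Oc r) (info_states SX Oc r)) SU
      (info_kernel SX Q Oc r \<rho>)"
    using stochastic_info_kernel by (simp add: info_space_def)
  fix t
  show "info t \<in> H t \<rightarrow>\<^sub>M info_ambient SX Oc r" by (rule info_H[OF order_refl])
  then show "info t \<in> M \<rightarrow>\<^sub>M info_ambient SX Oc r" by (rule measurable_from_subalg[OF subalgebra_H])
  show "AE \<omega> in M. info t \<omega> \<in> info_states SX Oc r" by (rule info_in_states)
  show "U t \<in> M \<rightarrow>\<^sub>M SU" by (rule measurable_from_subalg[OF subalgebra_H U_H])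
  show "U t \<in> history M (info_ambient SX Oc r) info SU U t \<rightarrow>\<^sub>M SU"
    by (rule measurable_mono_sets[OF U_H sets_H_info_history]) simp
  fix D assume "D \<in> sets (restrict_space (info_ambient SX Oc r) (info_states SX Oc r))"
  then have "D \<in> sets (info_ambient SX Oc r)" using sets_info_space_subset by (auto simp: info_space_def)
  then show "AE \<omega> in M. cond_probability M (history_action M (info_ambient SX Oc r) info SU U t)
      (info (Suc t)) D \<omega> = info_kernel SX Q Oc r \<rho> D (info t \<omega>) (U t \<omega>)"
    by (rule info_transition[OF sets_info_history_action])
qed

end

section \<open>Noise independent of the past\<close>

lemma sigma_algebra_process_events: "sigma_algebra (space M) (process_events M S Z T)"
  unfolding process_events_def by (rule sigma_algebra_sigma_sets) auto

lemma process_events_mono: "T \<subseteq> T' \<Longrightarrow> process_events M S Z T \<subseteq> process_events M S Z T'"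
  unfolding process_events_def by (intro sigma_sets_subseteq UN_mono) auto

lemma process_events_Int:
  assumes "a \<in> process_events M S Z T" "b \<in> process_events M S Z T"
  shows "a \<inter> b \<in> process_events M S Z T"
proof -
  interpret sigma_algebra "space M" "process_events M S Z T" by (rule sigma_algebra_process_events)
  show ?thesis using assms by (rule Int)
qed

lemma space_in_process_events: "space M \<in> process_events M S Z T"
  unfolding process_events_def by (rule sigma_sets_top)

context prob_space
begin

text \<open>
  Group an independent sequence into the two blocks of indices \<open>{1..t}\<close> and \<open>{t + 1}\<close>.
\<close>

lemma indep_past_next:
  assumes "indep_vars (\<lambda>_. S) Z {1..}"
  shows "indep_set (process_events M S Z {1..t}) (process_events M S Z {Suc t})"
proof -
  let ?E = "\<lambda>i. {Z i -` A \<inter> space M | A. A \<in> sets S}"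
  let ?I = "case_bool {1..t} {Suc t}"
  have "indep_sets ?E {1..}" using assms unfolding indep_vars_def2 by simp
  then have "indep_sets ?E (\<Union>j. ?I j)"
    by (rule indep_sets_mono_index[rotated]) (auto split: bool.splits)
  moreover have "Int_stable (?E i)" for i
  proof (rule Int_stableI)
    fix a b assume "a \<in> ?E i" "b \<in> ?E i"
    then obtain A B where "A \<in> sets S" "B \<in> sets S" "a = Z i -` A \<inter> space M" "b = Z i -` B \<inter> space M"
      by auto
    then show "a \<inter> b \<in> ?E i" by (auto intro!: exI[of _ "A \<inter> B"])
  qed
  moreover have "disjoint_family ?I" by (auto simp: disjoint_family_on_def split: bool.splits)
  ultimately have "indep_sets (\<lambda>j. sigma_sets (space M) (\<Union>i\<in>?I j. ?E i)) UNIV"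
    by (rule indep_sets_collect_sigma)
  also have "(\<lambda>j. sigma_sets (space M) (\<Union>i\<in>?I j. ?E i)) =
      case_bool (process_events M S Z {1..t}) (process_events M S Z {Suc t})"
    by (auto simp: process_events_def split: bool.splits)
  finally show ?thesis unfolding indep_set_def .
qed

lemma prob_Int_three:
  assumes "indep_sets (\<lambda>i. [\<A>, \<B>, \<C>] ! i) {..<3}" "a \<in> \<A>" "b \<in> \<B>" "c \<in> \<C>"
  shows "prob (a \<inter> b \<inter> c) = prob a * prob b * prob c"
proof -
  have three: "{..<3} = {0, 1, 2 :: nat}" by auto
  have "prob (\<Inter>j\<in>{..<3}. [a, b, c] ! j) = (\<Prod>j\<in>{..<3}. prob ([a, b, c] ! j))"
    by (rule indep_setsD[OF assms(1)]) (use assms(2-) in \<open>auto simp: three\<close>)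
  then show ?thesis by (simp add: three Int_assoc mult.assoc)
qed

end

text \<open>
  That actions are determined by the past is not part of the locale: it is a hypothesis of the two lemmas
  about the next state, because it is proved by an induction over time that uses the first of them.
\<close>

locale noise_driven_system = prob_space M for M :: "'w measure" +
  fixes SX :: "'x measure" and SU :: "'u measure" and SE :: "'e measure" and SV :: "'v measure"
    and \<nu>\<^sub>\<eta> :: "'e measure" and \<nu>\<^sub>\<epsilon> :: "'v measure"
    and G :: "'x \<times> 'u \<times> 'e \<times> 'v \<Rightarrow> 'x"
    and X :: "nat \<Rightarrow> 'w \<Rightarrow> 'x" and U :: "nat \<Rightarrow> 'w \<Rightarrow> 'u"
    and \<eta> :: "nat \<Rightarrow> 'w \<Rightarrow> 'e" and \<epsilon> :: "nat \<Rightarrow> 'w \<Rightarrow> 'v"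
  assumes G: "G \<in> SX \<Otimes>\<^sub>M SU \<Otimes>\<^sub>M SE \<Otimes>\<^sub>M SV \<rightarrow>\<^sub>M SX"
    and X0: "X 0 \<in> M \<rightarrow>\<^sub>M SX"
    and dynamics: "\<And>t \<omega>. \<omega> \<in> space M \<Longrightarrow>
           X (Suc t) \<omega> = G (X t \<omega>, U t \<omega>, \<eta> (Suc t) \<omega>, \<epsilon> (Suc t) \<omega>)"
    and eta_indep: "indep_vars (\<lambda>_. SE) \<eta> {1..}"
    and eta_law: "\<And>t. t \<ge> 1 \<Longrightarrow> distr M SE (\<eta> t) = \<nu>\<^sub>\<eta>"
    and eps_indep: "indep_vars (\<lambda>_. SV) \<epsilon> {1..}"
    and eps_law: "\<And>t. t \<ge> 1 \<Longrightarrow> distr M SV (\<epsilon> t) = \<nu>\<^sub>\<epsilon>"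
    and indep: "indep_sets
           (\<lambda>i. [process_events M SX X {0}, process_events M SE \<eta> {1..},
                 process_events M SV \<epsilon> {1..}] ! i) {..<3}"
begin

abbreviation "\<nu> \<equiv> \<nu>\<^sub>\<eta> \<Otimes>\<^sub>M \<nu>\<^sub>\<epsilon>"
abbreviation "noise t \<omega> \<equiv> (\<eta> t \<omega>, \<epsilon> t \<omega>)"

lemma eta_M: "t \<ge> 1 \<Longrightarrow> \<eta> t \<in> M \<rightarrow>\<^sub>M SE" and eps_M: "t \<ge> 1 \<Longrightarrow> \<epsilon> t \<in> M \<rightarrow>\<^sub>M SV"
  using eta_indep eps_indep unfolding indep_vars_def2 by auto

lemma sets_nu_eta [measurable_cong, simp]: "sets \<nu>\<^sub>\<eta> = sets SE"
  and sets_nu_eps [measurable_cong, simp]: "sets \<nu>\<^sub>\<epsilon> = sets SV"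
  using eta_law[of 1] eps_law[of 1] by (auto dest!: arg_cong[where f=sets])

lemma prob_space_nu_eta: "prob_space \<nu>\<^sub>\<eta>" and prob_space_nu_eps: "prob_space \<nu>\<^sub>\<epsilon>"
  using eta_law[of 1] eps_law[of 1] prob_space_distr[OF eta_M[of 1]] prob_space_distr[OF eps_M[of 1]]
  by auto

lemma sets_nu: "sets \<nu> = sets (SE \<Otimes>\<^sub>M SV)"
  by (rule sets_pair_measure_cong[OF sets_nu_eta sets_nu_eps])

lemma nu_in_space: "\<nu> \<in> space (prob_algebra (SE \<Otimes>\<^sub>M SV))"
  unfolding space_prob_algebra
  using sets_nu prob_space_pair[OF prob_space_nu_eta prob_space_nu_eps] by blast

text \<open>
  Intersections, rather than the union of the three families, make the generator stable under
  intersection, as Dynkin's theorem requires. Noises are indexed from 1, so for \<open>t = 0\<close> both noise families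
  are trivial.
\<close>

definition past_generator :: "nat \<Rightarrow> 'w set set" where
  "past_generator t = {a \<inter> b \<inter> c | a b c. a \<in> process_events M SX X {0} \<and>
     b \<in> process_events M SE \<eta> {1..t} \<and> c \<in> process_events M SV \<epsilon> {1..t}}"

definition past :: "nat \<Rightarrow> 'w measure" where
  "past t = sigma (space M) (past_generator t)"

lemma past_generator_Pow: "past_generator t \<subseteq> Pow (space M)"
  unfolding past_generator_def using process_events_subset_Pow[of M SX X "{0}"] by blast

lemma space_past [simp]: "space (past t) = space M"
  and sets_past: "sets (past t) = sigma_sets (space M) (past_generator t)"
  unfolding past_def using past_generator_Pow by (simp_all add: space_measure_of sets_measure_of)

lemma process_events_past:
  "process_events M SX X {0} \<subseteq> sets (past t)"
  "process_events M SE \<eta> {1..t} \<subseteq> sets (past t)"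
  "process_events M SV \<epsilon> {1..t} \<subseteq> sets (past t)"
proof -
  note top = space_in_process_events[of M SX X "{0}"] space_in_process_events[of M SE \<eta> "{1..t}"]
    space_in_process_events[of M SV \<epsilon> "{1..t}"]
  have "process_events M SX X {0} \<union> process_events M SE \<eta> {1..t} \<union> process_events M SV \<epsilon> {1..t}
      \<subseteq> past_generator t"
  proof
    fix a assume a: "a \<in> process_events M SX X {0} \<union> process_events M SE \<eta> {1..t} \<union> process_events M SV \<epsilon> {1..t}"
    then have "a \<subseteq> space M"
      using process_events_subset_Pow[of M SX X "{0}"] process_events_subset_Pow[of M SE \<eta> "{1..t}"]
        process_events_subset_Pow[of M SV \<epsilon> "{1..t}"] by blast
    then have "a = a \<inter> space M \<inter> space M" "a = space M \<inter> a \<inter> space M" "a = space M \<inter> space M \<inter> a"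
      by auto
    with a top show "a \<in> past_generator t" unfolding past_generator_def by blast
  qed
  also have "\<dots> \<subseteq> sets (past t)" unfolding sets_past by (auto intro: sigma_sets.Basic)
  finally show "process_events M SX X {0} \<subseteq> sets (past t)"
    "process_events M SE \<eta> {1..t} \<subseteq> sets (past t)" "process_events M SV \<epsilon> {1..t} \<subseteq> sets (past t)"
    by auto
qed

lemma past_generator_mono: "s \<le> t \<Longrightarrow> past_generator s \<subseteq> past_generator t"
  unfolding past_generator_def
  using process_events_mono[of "{1..s}" "{1..t}" M SE \<eta>] process_events_mono[of "{1..s}" "{1..t}" M SV \<epsilon>]
    atLeastatMost_subset_iff[of 1 s 1 t]
  by blast

lemma sets_past_mono: "s \<le> t \<Longrightarrow> sets (past s) \<subseteq> sets (past t)"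
  unfolding sets_past by (intro sigma_sets_subseteq past_generator_mono)

lemma X0_past: "X 0 \<in> past t \<rightarrow>\<^sub>M SX"
proof (rule measurableI)
  show "X 0 -` B \<inter> space (past t) \<in> sets (past t)" if "B \<in> sets SX" for B
    using vimage_in_process_events[of 0 "{0}" B SX X M] that process_events_past(1) by auto
qed (use measurable_space[OF X0] in auto)

lemma noise_past:
  assumes "1 \<le> s" "s \<le> t"
  shows "noise s \<in> past t \<rightarrow>\<^sub>M SE \<Otimes>\<^sub>M SV"
proof (rule measurable_Pair)
  show "\<eta> s \<in> past t \<rightarrow>\<^sub>M SE"
  proof (rule measurableI)
    show "\<eta> s -` B \<inter> space (past t) \<in> sets (past t)" if "B \<in> sets SE" for B
      using vimage_in_process_events[of s "{1..t}" B SE \<eta> M] that assms process_events_past(2) by auto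
  qed (use measurable_space[OF eta_M] assms in auto)
  show "\<epsilon> s \<in> past t \<rightarrow>\<^sub>M SV"
  proof (rule measurableI)
    show "\<epsilon> s -` B \<inter> space (past t) \<in> sets (past t)" if "B \<in> sets SV" for B
      using vimage_in_process_events[of s "{1..t}" B SV \<epsilon> M] that assms process_events_past(3) by auto
  qed (use measurable_space[OF eps_M] assms in auto)
qed

lemma process_events_in_events:
  "process_events M SX X {0} \<subseteq> events"
  "process_events M SE \<eta> {1..} \<subseteq> events"
  "process_events M SV \<epsilon> {1..} \<subseteq> events"
  using X0 eta_M eps_M by (intro process_events_subset_sets; simp)+

lemma past_generator_events: "past_generator t \<subseteq> events"
proof
  fix e assume "e \<in> past_generator t"
  then obtain a b c where e: "e = a \<inter> b \<inter> c" and "a \<in> process_events M SX X {0}"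
    "b \<in> process_events M SE \<eta> {1..t}" "c \<in> process_events M SV \<epsilon> {1..t}"
    unfolding past_generator_def by auto
  then have "a \<in> events" "b \<in> events" "c \<in> events"
    using process_events_in_events process_events_mono[of "{1..t}" "{1..}" M SE \<eta>]
      process_events_mono[of "{1..t}" "{1..}" M SV \<epsilon>] by auto
  then show "e \<in> events" unfolding e by auto
qed

lemma subalgebra_past: "subalgebra M (past t)"
  unfolding subalgebra_def sets_past
  using sets.sigma_sets_subset[OF past_generator_events] by simp

definition noise_generator :: "nat \<Rightarrow> 'w set set" where
  "noise_generator t = {b \<inter> c | b c. b \<in> process_events M SE \<eta> {t} \<and> c \<in> process_events M SV \<epsilon> {t}}"

text \<open>
  Independence between the three sources splits a probability into three factors; independence in time
  then splits off the factors at time \<open>t + 1\<close> in the two noise sources.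
\<close>

lemma indep_past_noise: "indep_set (past_generator t) (noise_generator (Suc t))"
proof (rule indep_setI)
  show "past_generator t \<subseteq> events" by (rule past_generator_events)
  have mono: "process_events M SE \<eta> {1..t} \<subseteq> process_events M SE \<eta> {1..}"
    "process_events M SV \<epsilon> {1..t} \<subseteq> process_events M SV \<epsilon> {1..}"
    "process_events M SE \<eta> {Suc t} \<subseteq> process_events M SE \<eta> {1..}"
    "process_events M SV \<epsilon> {Suc t} \<subseteq> process_events M SV \<epsilon> {1..}"
    by (rule process_events_mono; auto)+
  show "noise_generator (Suc t) \<subseteq> events"
    unfolding noise_generator_def using mono process_events_in_events by blast
  fix p n assume "p \<in> past_generator t" "n \<in> noise_generator (Suc t)"
  then obtain a b c b' c' where p: "p = a \<inter> b \<inter> c" and n: "n = b' \<inter> c'"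
    and a: "a \<in> process_events M SX X {0}"
    and b: "b \<in> process_events M SE \<eta> {1..t}" and c: "c \<in> process_events M SV \<epsilon> {1..t}"
    and b': "b' \<in> process_events M SE \<eta> {Suc t}" and c': "c' \<in> process_events M SV \<epsilon> {Suc t}"
    unfolding past_generator_def noise_generator_def by blast
  note m = subsetD[OF mono(1) b] subsetD[OF mono(2) c] subsetD[OF mono(3) b'] subsetD[OF mono(4) c']
  have "c' \<subseteq> space M" "b' \<subseteq> space M"
    using c' b' process_events_subset_Pow[of M SV \<epsilon> "{Suc t}"] process_events_subset_Pow[of M SE \<eta> "{Suc t}"]
    by auto
  then have n': "n = space M \<inter> b' \<inter> c'" by (auto simp: n)
  have "p \<inter> n = a \<inter> (b \<inter> b') \<inter> (c \<inter> c')" by (auto simp: p n)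
  then have "prob (p \<inter> n) = prob a * prob (b \<inter> b') * prob (c \<inter> c')"
    using prob_Int_three[OF indep a process_events_Int[OF m(1,3)] process_events_Int[OF m(2,4)]] by simp
  also have "\<dots> = prob a * (prob b * prob b') * (prob c * prob c')"
    using indep_setD[OF indep_past_next[OF eta_indep] b b'] indep_setD[OF indep_past_next[OF eps_indep] c c']
    by simp
  also have "\<dots> = (prob a * prob b * prob c) * (prob (space M) * prob b' * prob c')"
    by (simp add: prob_space)
  also have "\<dots> = prob p * prob n"
    unfolding p n' prob_Int_three[OF indep a m(1,2)]
      prob_Int_three[OF indep space_in_process_events m(3,4)] ..
  finally show "prob (p \<inter> n) = prob p * prob n" .
qed

lemma indep_past_noise_sigma:
  "indep_set (sets (past t)) (sigma_sets (space M) (noise_generator (Suc t)))"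
  unfolding sets_past
proof (rule indep_set_sigma_sets[OF indep_past_noise])
  show "Int_stable (past_generator t)"
  proof (rule Int_stableI)
    fix p q assume "p \<in> past_generator t" "q \<in> past_generator t"
    then obtain a b c a' b' c' where "p = a \<inter> b \<inter> c" "q = a' \<inter> b' \<inter> c'"
      and "a \<in> process_events M SX X {0}" "a' \<in> process_events M SX X {0}"
      and "b \<in> process_events M SE \<eta> {1..t}" "b' \<in> process_events M SE \<eta> {1..t}"
      and "c \<in> process_events M SV \<epsilon> {1..t}" "c' \<in> process_events M SV \<epsilon> {1..t}"
      unfolding past_generator_def by blast
    then have "p \<inter> q = (a \<inter> a') \<inter> (b \<inter> b') \<inter> (c \<inter> c')"
      "a \<inter> a' \<in> process_events M SX X {0}" "b \<inter> b' \<in> process_events M SE \<eta> {1..t}"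
      "c \<inter> c' \<in> process_events M SV \<epsilon> {1..t}"
      by (auto intro: process_events_Int)
    then show "p \<inter> q \<in> past_generator t" unfolding past_generator_def by blast
  qed
  show "Int_stable (noise_generator (Suc t))"
  proof (rule Int_stableI)
    fix p q assume "p \<in> noise_generator (Suc t)" "q \<in> noise_generator (Suc t)"
    then obtain b c b' c' where "p = b \<inter> c" "q = b' \<inter> c'"
      and "b \<in> process_events M SE \<eta> {Suc t}" "b' \<in> process_events M SE \<eta> {Suc t}"
      and "c \<in> process_events M SV \<epsilon> {Suc t}" "c' \<in> process_events M SV \<epsilon> {Suc t}"
      unfolding noise_generator_def by blast
    then have "p \<inter> q = (b \<inter> b') \<inter> (c \<inter> c')"
      "b \<inter> b' \<in> process_events M SE \<eta> {Suc t}" "c \<inter> c' \<in> process_events M SV \<epsilon> {Suc t}"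
      by (auto intro: process_events_Int)
    then show "p \<inter> q \<in> noise_generator (Suc t)" unfolding noise_generator_def by blast
  qed
qed

lemma prob_noise_rectangle:
  assumes "b \<in> process_events M SE \<eta> {1..}" "c \<in> process_events M SV \<epsilon> {1..}"
  shows "prob (b \<inter> c) = prob b * prob c"
proof -
  have "b \<subseteq> space M" using assms(1) process_events_subset_Pow[of M SE \<eta> "{1..}"] by auto
  then have "b \<inter> c = space M \<inter> b \<inter> c" by auto
  then show ?thesis
    using prob_Int_three[OF indep space_in_process_events assms] by (simp add: prob_space)
qed

lemma noise_M: "t \<ge> 1 \<Longrightarrow> noise t \<in> M \<rightarrow>\<^sub>M SE \<Otimes>\<^sub>M SV"
  using eta_M eps_M by (rule measurable_Pair)

lemma noise_law:
  assumes t: "t \<ge> 1"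
  shows "distr M (SE \<Otimes>\<^sub>M SV) (noise t) = \<nu>"
proof (rule pair_measure_eqI[symmetric])
  show "sigma_finite_measure \<nu>\<^sub>\<eta>" "sigma_finite_measure \<nu>\<^sub>\<epsilon>"
    using prob_space_nu_eta prob_space_nu_eps by (auto intro: prob_space_imp_sigma_finite)
  show "sets \<nu> = sets (distr M (SE \<Otimes>\<^sub>M SV) (noise t))"
    unfolding sets_distr by (rule sets_nu)
  fix A B assume "A \<in> sets \<nu>\<^sub>\<eta>" "B \<in> sets \<nu>\<^sub>\<epsilon>"
  then have A: "A \<in> sets SE" and B: "B \<in> sets SV" by simp_all
  let ?a = "\<eta> t -` A \<inter> space M" and ?b = "\<epsilon> t -` B \<inter> space M"
  have "emeasure \<nu>\<^sub>\<eta> A * emeasure \<nu>\<^sub>\<epsilon> B = emeasure M ?a * emeasure M ?b"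
    unfolding eta_law[OF t, symmetric] eps_law[OF t, symmetric]
    by (simp only: emeasure_distr[OF eta_M[OF t] A] emeasure_distr[OF eps_M[OF t] B])
  also have "\<dots> = emeasure M (?a \<inter> ?b)"
    using prob_noise_rectangle[of ?a ?b] vimage_in_process_events[of t "{1..}" A SE \<eta> M]
      vimage_in_process_events[of t "{1..}" B SV \<epsilon> M] t A B
    by (simp add: emeasure_eq_measure ennreal_mult)
  also have "?a \<inter> ?b = noise t -` (A \<times> B) \<inter> space M" by auto
  also have "emeasure M \<dots> = emeasure (distr M (SE \<Otimes>\<^sub>M SV) (noise t)) (A \<times> B)"
    by (rule emeasure_distr[symmetric, OF noise_M[OF t] pair_measureI[OF A B]])
  finally show "emeasure \<nu>\<^sub>\<eta> A * emeasure \<nu>\<^sub>\<epsilon> B = emeasure (distr M (SE \<Otimes>\<^sub>M SV) (noise t)) (A \<times> B)" .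
qed

lemma noise_event:
  assumes W: "W \<in> sets (SE \<Otimes>\<^sub>M SV)" and t: "t \<ge> 1"
  shows "noise t -` W \<inter> space M \<in> sigma_sets (space M) (noise_generator t)"
proof -
  have ng: "noise_generator t \<subseteq> Pow (space M)"
    unfolding noise_generator_def using process_events_subset_Pow[of M SE \<eta> "{t}"] by blast
  define N where "N = sigma (space M) (noise_generator t)"
  have space_N: "space N = space M" and sets_N: "sets N = sigma_sets (space M) (noise_generator t)"
    unfolding N_def using ng by (simp_all add: space_measure_of sets_measure_of)
  have gen: "b \<inter> c \<in> sets N" if "b \<in> process_events M SE \<eta> {t}" "c \<in> process_events M SV \<epsilon> {t}" for b c
    unfolding sets_N using that by (intro sigma_sets.Basic) (auto simp: noise_generator_def)
  have "\<eta> t \<in> N \<rightarrow>\<^sub>M SE"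
  proof (rule measurableI)
    show "\<eta> t -` B \<inter> space N \<in> sets N" if "B \<in> sets SE" for B
      using gen[OF vimage_in_process_events[of t "{t}" B SE \<eta> M] space_in_process_events] that
      by (simp add: space_N Int_assoc)
  qed (use measurable_space[OF eta_M[OF t]] space_N in auto)
  moreover have "\<epsilon> t \<in> N \<rightarrow>\<^sub>M SV"
  proof (rule measurableI)
    show "\<epsilon> t -` B \<inter> space N \<in> sets N" if "B \<in> sets SV" for B
      using gen[OF space_in_process_events vimage_in_process_events[of t "{t}" B SV \<epsilon> M]] that
      by (simp add: space_N Int_absorb1)
  qed (use measurable_space[OF eps_M[OF t]] space_N in auto)
  ultimately have "noise t \<in> N \<rightarrow>\<^sub>M SE \<Otimes>\<^sub>M SV" by (rule measurable_Pair)
  from measurable_sets[OF this W] show ?thesis by (simp add: space_N sets_N)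
qed

text \<open>
  Independence, stated as a conditional law that does not depend on the outcome.
\<close>

lemma cond_law_noise: "cond_law M (past t) (SE \<Otimes>\<^sub>M SV) (noise (Suc t)) (\<lambda>_. \<nu>)"
  unfolding cond_law_def
proof (intro conjI ballI)
  show "(\<lambda>_. \<nu>) \<in> past t \<rightarrow>\<^sub>M prob_algebra (SE \<Otimes>\<^sub>M SV)"
    by (rule measurable_const[OF nu_in_space])
  show N: "noise (Suc t) \<in> M \<rightarrow>\<^sub>M SE \<Otimes>\<^sub>M SV" by (rule noise_M) simp
  fix B W assume B: "B \<in> sets (past t)" and W: "W \<in> sets (SE \<Otimes>\<^sub>M SV)"
  have BM: "B \<in> events" using B subalgebra_past by (auto simp: subalgebra_def)
  let ?w = "noise (Suc t) -` W \<inter> space M"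
  have "emeasure M (B \<inter> {\<omega> \<in> space M. noise (Suc t) \<omega> \<in> W}) = emeasure M (B \<inter> ?w)"
    by (rule arg_cong[where f="emeasure M"]) auto
  also have "\<dots> = emeasure M B * emeasure M ?w"
    using indep_setD[OF indep_past_noise_sigma B noise_event[OF W]]
    by (simp add: emeasure_eq_measure ennreal_mult)
  also have "emeasure M ?w = emeasure \<nu> W"
    unfolding noise_law[of "Suc t", simplified, symmetric] by (rule emeasure_distr[symmetric, OF N W])
  also have "emeasure M B * emeasure \<nu> W = (\<integral>\<^sup>+ \<omega>. indicator B \<omega> * emeasure \<nu> W \<partial>M)"
    using BM by (simp add: nn_integral_multc)
  finally show "emeasure M (B \<inter> {\<omega> \<in> space M. noise (Suc t) \<omega> \<in> W}) =
      (\<integral>\<^sup>+ \<omega>. indicator B \<omega> * emeasure \<nu> W \<partial>M)" .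
qed

lemma measurable_G_section:
  assumes "x \<in> space SX" "u \<in> space SU"
  shows "(\<lambda>n. G (x, u, n)) \<in> \<nu> \<rightarrow>\<^sub>M SX"
proof -
  have "(\<lambda>n. (x, u, n)) \<in> SE \<Otimes>\<^sub>M SV \<rightarrow>\<^sub>M SX \<Otimes>\<^sub>M SU \<Otimes>\<^sub>M SE \<Otimes>\<^sub>M SV"
    using assms by (intro measurable_Pair measurable_const measurable_ident_sets[OF refl]) auto
  from measurable_compose[OF this G] show ?thesis
    unfolding measurable_cong_sets[OF sets_nu refl] .
qed

lemma transition_kernel_eq_distr:
  assumes "x \<in> space SX" "u \<in> space SU"
  shows "transition_kernel SX \<nu>\<^sub>\<eta> \<nu>\<^sub>\<epsilon> G x u = distr \<nu> SX (\<lambda>n. G (x, u, n))"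
proof -
  interpret E: prob_space \<nu>\<^sub>\<epsilon> by (rule prob_space_nu_eps)
  note m = measurable_G_section[OF assms]
  have "(\<integral>\<^sup>+ e. (\<integral>\<^sup>+ v. indicator C (G (x, u, e, v)) \<partial>\<nu>\<^sub>\<epsilon>) \<partial>\<nu>\<^sub>\<eta>)
      = emeasure (distr \<nu> SX (\<lambda>n. G (x, u, n))) C" if C: "C \<in> sets SX" for C
  proof -
    have "emeasure (distr \<nu> SX (\<lambda>n. G (x, u, n))) C = (\<integral>\<^sup>+ n. indicator C (G (x, u, n)) \<partial>\<nu>)"
      using C m by (simp add: nn_integral_indicator[symmetric] nn_integral_distr del: nn_integral_indicator)
    also have "\<dots> = (\<integral>\<^sup>+ e. (\<integral>\<^sup>+ v. indicator C (G (x, u, e, v)) \<partial>\<nu>\<^sub>\<epsilon>) \<partial>\<nu>\<^sub>\<eta>)"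
      by (rule E.nn_integral_fst[symmetric])
         (rule measurable_compose[OF m borel_measurable_indicator[OF C]])
    finally show ?thesis by simp
  qed
  then have "transition_kernel SX \<nu>\<^sub>\<eta> \<nu>\<^sub>\<epsilon> G x u =
      measure_of (space SX) (sets SX) (emeasure (distr \<nu> SX (\<lambda>n. G (x, u, n))))"
    unfolding transition_kernel_def
    by (intro measure_of_eq sets.space_closed) (simp add: sets.sigma_sets_eq)
  also have "\<dots> = distr \<nu> SX (\<lambda>n. G (x, u, n))"
    using measure_of_of_measure[of "distr \<nu> SX (\<lambda>n. G (x, u, n))"] by simp
  finally show ?thesis .
qed

lemma measurable_transition_kernel:
  "(\<lambda>(x, u). transition_kernel SX \<nu>\<^sub>\<eta> \<nu>\<^sub>\<epsilon> G x u) \<in> SX \<Otimes>\<^sub>M SU \<rightarrow>\<^sub>M prob_algebra SX"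
proof -
  have "(\<lambda>q. (fst (fst q), snd (fst q), snd q))
      \<in> (SX \<Otimes>\<^sub>M SU) \<Otimes>\<^sub>M (SE \<Otimes>\<^sub>M SV) \<rightarrow>\<^sub>M SX \<Otimes>\<^sub>M SU \<Otimes>\<^sub>M SE \<Otimes>\<^sub>M SV"
    by measurable
  from measurable_compose[OF this G]
  have "(\<lambda>(z, n). G (fst z, snd z, n)) \<in> (SX \<Otimes>\<^sub>M SU) \<Otimes>\<^sub>M (SE \<Otimes>\<^sub>M SV) \<rightarrow>\<^sub>M SX"
    by (simp add: case_prod_beta')
  from measurable_distr_prob_space2[OF measurable_const[OF nu_in_space] this]
  have "(\<lambda>z. distr \<nu> SX (\<lambda>n. G (fst z, snd z, n))) \<in> SX \<Otimes>\<^sub>M SU \<rightarrow>\<^sub>M prob_algebra SX" .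
  also have "?this \<longleftrightarrow> ?thesis"
    by (intro measurable_cong) (auto simp: space_pair_measure transition_kernel_eq_distr)
  finally show ?thesis .
qed

lemma X_Suc_past:
  assumes "X t \<in> past t \<rightarrow>\<^sub>M SX" "U t \<in> past t \<rightarrow>\<^sub>M SU"
  shows "X (Suc t) \<in> past (Suc t) \<rightarrow>\<^sub>M SX"
proof -
  have "(\<lambda>\<omega>. (X t \<omega>, U t \<omega>, noise (Suc t) \<omega>)) \<in> past (Suc t) \<rightarrow>\<^sub>M SX \<Otimes>\<^sub>M SU \<Otimes>\<^sub>M SE \<Otimes>\<^sub>M SV"
    by (intro measurable_Pair[of _ "past (Suc t)"] noise_past
        assms[THEN measurable_mono_sets, OF sets_past_mono]) auto
  from measurable_compose[OF this G]
  have "(\<lambda>\<omega>. G (X t \<omega>, U t \<omega>, noise (Suc t) \<omega>)) \<in> past (Suc t) \<rightarrow>\<^sub>M SX" .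
  also have "?this \<longleftrightarrow> ?thesis"
    by (intro measurable_cong) (simp add: dynamics)
  finally show ?thesis .
qed

text \<open>
  Given the past, \<open>X\<^sub>t\<close> and \<open>U\<^sub>t\<close> are fixed and the noise has law \<open>\<nu>\<close>; integrating it out of
  \<open>G (X\<^sub>t, U\<^sub>t, noise)\<close> gives \<open>Q\<close>.
\<close>

lemma emeasure_transition:
  assumes X: "X t \<in> past t \<rightarrow>\<^sub>M SX" and U: "U t \<in> past t \<rightarrow>\<^sub>M SU"
    and B[measurable]: "B \<in> sets (past t)" and C[measurable]: "C \<in> sets SX"
  shows "emeasure M (B \<inter> {\<omega> \<in> space M. X (Suc t) \<omega> \<in> C}) =
    (\<integral>\<^sup>+ \<omega>. indicator B \<omega> * emeasure (transition_kernel SX \<nu>\<^sub>\<eta> \<nu>\<^sub>\<epsilon> G (X t \<omega>) (U t \<omega>)) C \<partial>M)"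
proof -
  note [measurable] = X U G
  have XS: "X (Suc t) \<in> M \<rightarrow>\<^sub>M SX"
    by (rule measurable_from_subalg[OF subalgebra_past X_Suc_past[OF X U]])
  have BM: "B \<in> events" using subalgebra_past B unfolding subalgebra_def by (rule conjunct2[THEN subsetD])
  have ev: "{\<omega> \<in> space M. X (Suc t) \<omega> \<in> C} \<in> events"
    using measurable_sets[OF XS C] by (simp add: vimage_def Int_def conj_commute)
  let ?f = "\<lambda>\<omega> n. indicator B \<omega> * indicator C (G (X t \<omega>, U t \<omega>, n)) :: ennreal"
  have f: "(\<lambda>(\<omega>, n). ?f \<omega> n) \<in> borel_measurable (past t \<Otimes>\<^sub>M (SE \<Otimes>\<^sub>M SV))"
    unfolding case_prod_beta' by measurable
  have "emeasure M (B \<inter> {\<omega> \<in> space M. X (Suc t) \<omega> \<in> C}) =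
      (\<integral>\<^sup>+ \<omega>. indicator (B \<inter> {\<omega> \<in> space M. X (Suc t) \<omega> \<in> C}) \<omega> \<partial>M)"
    by (rule nn_integral_indicator[symmetric, OF sets.Int[OF BM ev]])
  also have "\<dots> = (\<integral>\<^sup>+ \<omega>. ?f \<omega> (noise (Suc t) \<omega>) \<partial>M)"
    by (rule nn_integral_cong) (auto simp: indicator_def dynamics)
  also have "\<dots> = (\<integral>\<^sup>+ \<omega>. (\<integral>\<^sup>+ n. ?f \<omega> n \<partial>\<nu>) \<partial>M)"
    by (rule nn_integral_cond_law[OF prob_space_axioms subalgebra_past cond_law_noise f])
  also have "\<dots> = (\<integral>\<^sup>+ \<omega>. indicator B \<omega> *
      emeasure (transition_kernel SX \<nu>\<^sub>\<eta> \<nu>\<^sub>\<epsilon> G (X t \<omega>) (U t \<omega>)) C \<partial>M)"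
  proof (rule nn_integral_cong)
    fix \<omega> assume "\<omega> \<in> space M"
    then have xu: "X t \<omega> \<in> space SX" "U t \<omega> \<in> space SU"
      using measurable_space[OF X] measurable_space[OF U] by auto
    note m = measurable_G_section[OF xu]
    have "emeasure (transition_kernel SX \<nu>\<^sub>\<eta> \<nu>\<^sub>\<epsilon> G (X t \<omega>) (U t \<omega>)) C =
        (\<integral>\<^sup>+ n. indicator C (G (X t \<omega>, U t \<omega>, n)) \<partial>\<nu>)"
      unfolding transition_kernel_eq_distr[OF xu]
      using C m by (simp add: nn_integral_indicator[symmetric] nn_integral_distr del: nn_integral_indicator)
    then show "(\<integral>\<^sup>+ n. ?f \<omega> n \<partial>\<nu>) =
        indicator B \<omega> * emeasure (transition_kernel SX \<nu>\<^sub>\<eta> \<nu>\<^sub>\<epsilon> G (X t \<omega>) (U t \<omega>)) C"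
      by (cases "\<omega> \<in> B") simp_all
  qed
  finally show ?thesis .
qed

end

section \<open>The observation cells form a partition\<close>

context
  fixes SX :: "'x measure" and A :: "nat \<Rightarrow> 'x set" and J :: "nat \<Rightarrow> nat set" and m r :: nat
  assumes A_sets: "\<And>i. i \<in> {1..m} \<Longrightarrow> A i \<in> sets SX"
    and A_disj: "disjoint_family_on A {1..m}"
    and J_sub: "\<And>j. j \<in> {1..r} \<Longrightarrow> J j \<subseteq> {1..m}"
    and J_disj: "disjoint_family_on J {1..r}"
begin

lemma union_cell_sets: "j \<in> {1..r} \<Longrightarrow> (\<Union>i\<in>J j. A i) \<in> sets SX"
  using J_sub[of j] A_sets finite_subset[OF J_sub] by (intro sets.finite_UN) auto

lemma obs_cell_sets:
  assumes "j \<in> {1..r + 1}"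
  shows "obs_cell SX A J r j \<in> sets SX"
proof (cases "j = r + 1")
  case True
  have "(\<Union>l\<in>{1..r}. \<Union>i\<in>J l. A i) \<in> sets SX" by (intro sets.finite_UN union_cell_sets) auto
  with True show ?thesis by (simp add: obs_cell_def sets.compl_sets)
qed (use assms union_cell_sets[of j] in \<open>auto simp: obs_cell_def\<close>)

lemma obs_cell_disjoint: "disjoint_family_on (obs_cell SX A J r) {1..r + 1}"
proof -
  have *: "obs_cell SX A J r j \<inter> obs_cell SX A J r k = {}"
    if "j \<in> {1..r + 1}" "k \<in> {1..r + 1}" "j < k" for j k
  proof (cases "k = r + 1")
    case True
    with that have "j \<in> {1..r}" "j \<noteq> r + 1" by auto
    with True show ?thesis unfolding obs_cell_def by auto
  next
    case False
    with that have jk: "j \<in> {1..r}" "k \<in> {1..r}" by auto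
    have "A i \<inter> A i' = {}" if "i \<in> J j" "i' \<in> J k" for i i'
    proof -
      have "J j \<inter> J k = {}" using J_disj jk \<open>j < k\<close> by (auto simp: disjoint_family_on_def)
      with that have "i \<noteq> i'" by auto
      then show ?thesis using A_disj J_sub[OF jk(1)] J_sub[OF jk(2)] that
        unfolding disjoint_family_on_def by blast
    qed
    with jk show ?thesis by (auto simp: obs_cell_def)
  qed
  show ?thesis unfolding disjoint_family_on_def
  proof (intro ballI impI)
    fix j k assume "j \<in> {1..r + 1}" "k \<in> {1..r + 1}" "j \<noteq> k"
    then show "obs_cell SX A J r j \<inter> obs_cell SX A J r k = {}"
      using *[of j k] *[of k j] by (cases "j < k") (auto simp: Int_commute)
  qed
qed

lemma obs_cell_cover: "(\<Union>j\<in>{1..r + 1}. obs_cell SX A J r j) = space SX"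
proof
  show "(\<Union>j\<in>{1..r + 1}. obs_cell SX A J r j) \<subseteq> space SX"
    using sets.sets_into_space[OF obs_cell_sets] by blast
  show "space SX \<subseteq> (\<Union>j\<in>{1..r + 1}. obs_cell SX A J r j)"
  proof
    fix x assume x: "x \<in> space SX"
    show "x \<in> (\<Union>j\<in>{1..r + 1}. obs_cell SX A J r j)"
    proof (cases "x \<in> (\<Union>l\<in>{1..r}. \<Union>i\<in>J l. A i)")
      case True
      then obtain l where "l \<in> {1..r}" "x \<in> (\<Union>i\<in>J l. A i)" by blast
      then have "l \<in> {1..r + 1}" "x \<in> obs_cell SX A J r l" by (auto simp: obs_cell_def)
      then show ?thesis by blast
    next
      case False
      with x have "x \<in> obs_cell SX A J r (r + 1)" by (simp add: obs_cell_def)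
      moreover have "r + 1 \<in> {1..r + 1}" by simp
      ultimately show ?thesis by blast
    qed
  qed
qed

end

section \<open>The information process of the controlled model\<close>

theorem theorem4:
  fixes M :: "'w measure"
    and SX :: "'x measure" and SU :: "'u measure" and SE :: "'e measure" and SV :: "'v measure"
    and \<nu>\<^sub>\<eta> :: "'e measure" and \<nu>\<^sub>\<epsilon> :: "'v measure"
    and G :: "'x \<times> 'u \<times> 'e \<times> 'v \<Rightarrow> 'x"
    and X :: "nat \<Rightarrow> 'w \<Rightarrow> 'x" and U :: "nat \<Rightarrow> 'w \<Rightarrow> 'u"
    and \<eta> :: "nat \<Rightarrow> 'w \<Rightarrow> 'e" and \<epsilon> :: "nat \<Rightarrow> 'w \<Rightarrow> 'v"
    and m r :: nat and A :: "nat \<Rightarrow> 'x set" and J :: "nat \<Rightarrow> nat set"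
    and Y :: "nat \<Rightarrow> 'w \<Rightarrow> nat" and \<pi> :: "nat \<Rightarrow> 'w \<Rightarrow> 'x measure"
    and \<rho> :: "nat \<Rightarrow> 'x measure"
    and Q :: "'x \<Rightarrow> 'u \<Rightarrow> 'x measure" and Oc :: "nat \<Rightarrow> 'x set"
    and H :: "nat \<Rightarrow> 'w measure" and I :: "nat \<Rightarrow> 'w \<Rightarrow> nat \<times> 'x measure"
    and K :: "(nat \<times> 'x measure) set \<Rightarrow> nat \<times> 'x measure \<Rightarrow> 'u \<Rightarrow> real"
  assumes "prob_space M" and "complete_measure M"
    and "standard_borel_space SX" and "standard_borel_space SU"
    and "standard_borel_space SE" and "standard_borel_space SV"
    and G: "G \<in> SX \<Otimes>\<^sub>M SU \<Otimes>\<^sub>M SE \<Otimes>\<^sub>M SV \<rightarrow>\<^sub>M SX"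
    and "X 0 \<in> M \<rightarrow>\<^sub>M SX"
    and dynamics: "\<And>t \<omega>. \<omega> \<in> space M \<Longrightarrow>
           X (Suc t) \<omega> = G (X t \<omega>, U t \<omega>, \<eta> (Suc t) \<omega>, \<epsilon> (Suc t) \<omega>)"
    and eta_indep: "prob_space.indep_vars M (\<lambda>_. SE) \<eta> {1..}"
    and eta_law: "\<And>t. t \<ge> 1 \<Longrightarrow> distr M SE (\<eta> t) = \<nu>\<^sub>\<eta>"
    and eps_indep: "prob_space.indep_vars M (\<lambda>_. SV) \<epsilon> {1..}"
    and eps_law: "\<And>t. t \<ge> 1 \<Longrightarrow> distr M SV (\<epsilon> t) = \<nu>\<^sub>\<epsilon>"
    and indep: "prob_space.indep_sets M
           (\<lambda>i. [process_events M SX X {0}, process_events M SE \<eta> {1..},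
                 process_events M SV \<epsilon> {1..}] ! i) {..<3}"
    and Q: "Q = transition_kernel SX \<nu>\<^sub>\<eta> \<nu>\<^sub>\<epsilon> G"
    and A_sets: "\<And>i. i \<in> {1..m} \<Longrightarrow> A i \<in> sets SX"
    and A_disj: "disjoint_family_on A {1..m}"
    and A_cover: "(\<Union>i\<in>{1..m}. A i) = space SX"
    and J_sub: "\<And>j. j \<in> {1..r} \<Longrightarrow> J j \<subseteq> {1..m} \<and> J j \<noteq> {}"
    and J_disj: "disjoint_family_on J {1..r}"
    and Oc: "Oc = obs_cell SX A J r"
    and Y: "\<And>t \<omega> j. \<omega> \<in> space M \<Longrightarrow> j \<in> {1..r + 1} \<Longrightarrow> Y t \<omega> = j \<longleftrightarrow> X t \<omega> \<in> Oc j"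
    and H: "H = history M (label_space Oc r) Y SU U"
    and U: "\<And>t. U t \<in> H t \<rightarrow>\<^sub>M SU"
    and pi_meas: "\<And>t. \<pi> t \<in> H t \<rightarrow>\<^sub>M prob_algebra SX"
    and pi_cond: "\<And>t C. C \<in> sets SX \<Longrightarrow>
           AE \<omega> in M. measure (\<pi> t \<omega>) C = cond_probability M (H t) (X t) C \<omega>"
    and rho: "\<And>k. k \<in> obs_labels Oc r \<Longrightarrow> \<rho> k \<in> space (prob_algebra SX) \<and> measure (\<rho> k) (Oc k) = 1"
    and I: "\<And>t \<omega>. I t \<omega> = (Y t \<omega>, \<pi> t \<omega>)"
    and K: "K = info_kernel SX Q Oc r \<rho>"
  shows "(\<forall>t. \<forall>D\<in>sets (info_space SX Oc r).
            AE \<omega> in M. cond_probability M (H t) (I (Suc t)) D \<omega> = K D (I t \<omega>) (U t \<omega>))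
       \<and> (\<forall>t. \<forall>D\<in>sets (info_space SX Oc r).
            AE \<omega> in M. cond_probability M (history_action M (info_ambient SX Oc r) I SU U t)
                          (I (Suc t)) D \<omega> = K D (I t \<omega>) (U t \<omega>))
       \<and> completely_observable_controlled_markov M H (info_ambient SX Oc r) (info_states SX Oc r)
            SU K I U"
proof -
  interpret S: noise_driven_system M SX SU SE SV \<nu>\<^sub>\<eta> \<nu>\<^sub>\<epsilon> G X U \<eta> \<epsilon>
    by (intro noise_driven_system.intro noise_driven_system_axioms.intro) fact+
  have J_sub': "\<And>j. j \<in> {1..r} \<Longrightarrow> J j \<subseteq> {1..m}" using J_sub by simp
  note cells = A_sets A_disj J_sub' J_disj
  interpret Fi: filter_model SX SU Q Oc r \<rho>
  proof
    show "(\<lambda>(x, u). Q x u) \<in> SX \<Otimes>\<^sub>M SU \<rightarrow>\<^sub>M prob_algebra SX"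
      unfolding Q by (rule S.measurable_transition_kernel)
    show "Oc k \<in> sets SX" if "k \<in> {1..r + 1}" for k
      unfolding Oc by (rule obs_cell_sets[where m = m]) (use cells that in blast)+
    show "disjoint_family_on Oc {1..r + 1}" 
      unfolding Oc by (rule obs_cell_disjoint[where m = m]) (use cells in blast)+
    show "(\<Union>k\<in>{1..r + 1}. Oc k) = space SX" 
      unfolding Oc by (rule obs_cell_cover[where m = m]) (use cells in blast)+
    show "\<rho> k \<in> space (prob_algebra SX)" "measure (\<rho> k) (Oc k) = 1" if "k \<in> obs_labels Oc r" for k
      using rho[OF that] by auto
  qed
  have space_H: "space (H t) = space M" for t by (simp add: H)
  \<comment> \<open>States and histories are treated together: a state depends on the previous action, an action on
    the history, and the history on earlier states and actions.\<close>
  have past: "X t \<in> S.past t \<rightarrow>\<^sub>M SX \<and> sets (H t) \<subseteq> sets (S.past t)" for t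
  proof (induction t rule: less_induct)
    case (less t)
    have U_past: "U s \<in> S.past s \<rightarrow>\<^sub>M SU" if "s < t" for s
      using less[OF that] by (intro measurable_mono_sets[OF U]) (simp_all add: space_H)
    have X_past: "X t \<in> S.past t \<rightarrow>\<^sub>M SX"
    proof (cases t)
      case 0
      then show ?thesis using S.X0_past by simp
    next
      case (Suc s)
      then show ?thesis using less[of s] U_past[of s] S.X_Suc_past[of s] by simp
    qed
    have "sets (H t) \<subseteq> sets (S.past t)"
      unfolding H
    proof (rule sets_history_subset)
      fix s assume "s \<le> t"
      then have "X s \<in> S.past s \<rightarrow>\<^sub>M SX" using less[of s] X_past by (cases "s = t") auto
      then have "X s \<in> S.past t \<rightarrow>\<^sub>M SX"
        by (rule measurable_mono_sets[OF _ S.sets_past_mono[OF \<open>s \<le> t\<close>]]) simp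
      then show "Y s \<in> S.past t \<rightarrow>\<^sub>M label_space Oc r"
        by (rule Fi.measurable_label) (use Y in simp)
    next
      fix s assume "s < t"
      then show "U s \<in> S.past t \<rightarrow>\<^sub>M SU"
        by (intro measurable_mono_sets[OF U_past S.sets_past_mono]) auto
    qed simp
    with X_past show ?case by blast
  qed
  have U_past: "U t \<in> S.past t \<rightarrow>\<^sub>M SU" for t
    using past[of t] by (intro measurable_mono_sets[OF U]) (simp_all add: space_H)
  interpret P: partially_observed_process SX SU Q Oc r \<rho> M X U Y \<pi> H
  proof
    show "X t \<in> M \<rightarrow>\<^sub>M SX" for t
      by (rule measurable_from_subalg[OF S.subalgebra_past conjunct1[OF past]])
    show "emeasure M (B \<inter> {\<omega> \<in> space M. X (Suc t) \<omega> \<in> C}) =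
        (\<integral>\<^sup>+ \<omega>. indicator B \<omega> * emeasure (Q (X t \<omega>) (U t \<omega>)) C \<partial>M)"
      if "B \<in> sets (H t)" "C \<in> sets SX" for t B C
      unfolding Q using past[of t] U_past[of t] that by (intro S.emeasure_transition) auto
  qed (fact Y H U pi_meas pi_cond)+
  have I_eq: "I = (\<lambda>t \<omega>. (Y t \<omega>, \<pi> t \<omega>))" by (intro ext) (rule I)
  have D_ambient: "D \<in> sets (info_ambient SX Oc r)" if "D \<in> sets (info_space SX Oc r)" for D
    using that Fi.sets_info_space_subset by blast
  show ?thesis
    unfolding I_eq K
    using P.info_transition[OF refl D_ambient] P.info_transition[OF P.sets_info_history_action D_ambient]
      P.info_process_controlled_markov
    by blast
qed

end
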